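(* Let $\mathbf{k}$ be a commutative ring with unit. The quintuple $(H_{\rm LR}^{\epsilon},\backslash,|,\Delta_{\rm LR}^{\epsilon},\vee)$ of planar binary trees is a unitary infinitesimal $(\backslash,\vee)$-bialgebra.
   Context: All modules, algebras, tensor products and linear maps are over $\mathbf{k}$. Planar binary trees: a planar binary tree is a finite rooted planar tree in which every internal vertex has exactly two ordered incoming branches (left and right). The trivial tree, with no internal vertices, is denoted $|$. Let $\mathcal{Y}$ be the set of planar binary trees and $H_{\rm LR}^{\epsilon}:=\mathbf{k}\mathcal{Y}$ the free $\mathbf{k}$-module on it. Grafting: for $T_l,T_r\in\mathcal{Y}$, $T_l\vee T_r$ is the tree obtained by creating a new root with left branch $T_l$ and right branch $T_r$; $\vee$ is extended bilinearly. Every $T\in\mathcal{Y}$ with $T\neq |$ is uniquely of the form $T=T_l\vee T_r$. Under product: the bilinear map $\backslash$ on $H_{\rm LR}^{\epsilon}$ where, for trees $S,T$, $S\backslash T$ is obtained by adjoining the root of $T$ to the rightmost branch of $S$; recursively, $|\backslash T=T$ and $(S_l\vee S_r)\backslash T=S_l\vee(S_r\backslash T)$. The unit is $|$. Infinitesimal coproduct: the linear map $\Delta_{\rm LR}^{\epsilon}:H_{\rm LR}^{\epsilon}\to H_{\rm LR}^{\epsilon}\otimes H_{\rm LR}^{\epsilon}$ defined on trees recursively by $\Delta_{\rm LR}^{\epsilon}(|)=0$ and $$\Delta_{\rm LR}^{\epsilon}(T_l\vee T_r)=T_l\otimes T_r+(\mathrm{id}\otimes\vee)(\Delta_{\rm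 LR}^{\epsilon}(T_l)\otimes T_r)+(\vee\otimes\mathrm{id})(T_l\otimes\Delta_{\rm LR}^{\epsilon}(T_r)).$$ A unitary infinitesimal bialgebra (of weight zero) is a quadruple $(A,\cdot,1_A,\Delta)$ where $(A,\cdot,1_A)$ is a unitary associative algebra and $\Delta:A\to A\otimes A$ is a coassociative linear map (a counit is not required) such that $\Delta(ab)=a\cdot\Delta(b)+\Delta(a)\cdot b$ for all $a,b\in A$, where $a\cdot(u\otimes v)=(au)\otimes v$ and $(u\otimes v)\cdot b=u\otimes(vb)$. A unitary $(\backslash,\vee)$-algebra is a unitary associative algebra $(H,\backslash_H,1_H)$ together with a bilinear map $\vee_H:H\otimes H\to H$ such that $(x\vee_H y)\backslash_H z=x\vee_H(y\backslash_H z)$ for all $x,y,z\in H$. A unitary infinitesimal $(\backslash,\vee)$-bialgebra is a quintuple $(H,\backslash_H,1_H,\Delta_H,\vee_H)$ such that (a) $(H,\backslash_H,1_H,\vee_H)$ is a unitary $(\backslash,\vee)$-algebra; (b) $(H,\backslash_H,1_H,\Delta_H)$ is a unitary infinitesimal bialgebra; (c) for all $x,y\in H$, $$\Delta_H(x\vee_H y)=x\otimes y+(\mathrm{id}\otimes\vee_H)(\Delta_H(x)\otimes y)+(\vee_H\otimes\mathrm{id})(x\otimes\Delta_H(y)).$$ *)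

theory Defs
  imports "HOL-Algebra.Module" "HOL-Algebra.AbelCoset"
begin

section \<open>Linear and bilinear maps, free modules, quotients\<close>

definition linear_maps ::
    "('k, 'r) ring_scheme \<Rightarrow> ('k, 'a, 's) module_scheme \<Rightarrow> ('k, 'b, 't) module_scheme \<Rightarrow> ('a \<Rightarrow> 'b) set"
  where
  "linear_maps R M N =
    {f \<in> carrier M \<rightarrow> carrier N.
      (\<forall>x\<in>carrier M. \<forall>y\<in>carrier M. f (x \<oplus>\<^bsub>M\<^esub> y) = f x \<oplus>\<^bsub>N\<^esub> f y) \<and>
      (\<forall>c\<in>carrier R. \<forall>x\<in>carrier M. f (c \<odot>\<^bsub>M\<^esub> x) = c \<odot>\<^bsub>N\<^esub> f x)}"

definition bilinear_maps ::
    "('k, 'r) ring_scheme \<Rightarrow> ('k, 'a, 's) module_scheme \<Rightarrow> ('k, 'b, 't) module_scheme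
      \<Rightarrow> ('k, 'c, 'u) module_scheme \<Rightarrow> ('a \<Rightarrow> 'b \<Rightarrow> 'c) set"
  where
  "bilinear_maps R M N P =
    {\<beta>. (\<forall>x\<in>carrier M. (\<lambda>y. \<beta> x y) \<in> linear_maps R N P) \<and>
         (\<forall>y\<in>carrier N. (\<lambda>x. \<beta> x y) \<in> linear_maps R M P)}"

text \<open>The multiplicative fields of a module record carry no information for a module; the
  constructions below leave them \<open>undefined\<close>.\<close>

definition free_module :: "('k, 'r) ring_scheme \<Rightarrow> 's set \<Rightarrow> ('k, 's \<Rightarrow> 'k) module" where
  "free_module R S =
    \<lparr>carrier = {f. (\<forall>s. f s \<in> carrier R) \<and> (\<forall>s. s \<notin> S \<longrightarrow> f s = \<zero>\<^bsub>R\<^esub>) \<and> finite {s. f s \<noteq> \<zero>\<^bsub>R\<^esub>}},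
     mult = undefined, one = undefined,
     zero = (\<lambda>s. \<zero>\<^bsub>R\<^esub>),
     add = (\<lambda>f g s. f s \<oplus>\<^bsub>R\<^esub> g s),
     smult = (\<lambda>c f s. c \<otimes>\<^bsub>R\<^esub> f s)\<rparr>"

definition basis_vec :: "('k, 'r) ring_scheme \<Rightarrow> 's \<Rightarrow> 's \<Rightarrow> 'k" where
  "basis_vec R s = (\<lambda>t. if t = s then \<one>\<^bsub>R\<^esub> else \<zero>\<^bsub>R\<^esub>)"

text \<open>Linear extension to \<open>free_module R S\<close> of \<open>\<phi>\<close> from \<open>S\<close> to \<open>M\<close>. The set \<open>S\<close> is not an argument:
  the sum runs over the support of \<open>f\<close>.\<close>

definition free_lift ::
    "('k, 'r) ring_scheme \<Rightarrow> ('k, 'a, 't) module_scheme \<Rightarrow> ('s \<Rightarrow> 'a) \<Rightarrow> ('s \<Rightarrow> 'k) \<Rightarrow> 'a"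
  where
  "free_lift R M \<phi> f = finsum M (\<lambda>s. f s \<odot>\<^bsub>M\<^esub> \<phi> s) {s. f s \<noteq> \<zero>\<^bsub>R\<^esub>}"

definition free_lift2 ::
    "('k, 'r) ring_scheme \<Rightarrow> ('k, 'a, 't) module_scheme \<Rightarrow> ('s \<Rightarrow> 's \<Rightarrow> 'a)
      \<Rightarrow> ('s \<Rightarrow> 'k) \<Rightarrow> ('s \<Rightarrow> 'k) \<Rightarrow> 'a"
  where
  "free_lift2 R M \<phi> f g = free_lift R M (\<lambda>s. free_lift R M (\<phi> s) g) f"

definition submodule_generated ::
    "('k, 'r) ring_scheme \<Rightarrow> ('k, 'a, 's) module_scheme \<Rightarrow> 'a set \<Rightarrow> 'a set"
  where
  "submodule_generated R M X = \<Inter>{N. submodule N R M \<and> X \<subseteq> N}"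

definition quotient_module ::
    "('k, 'a, 's) module_scheme \<Rightarrow> 'a set \<Rightarrow> ('k, 'a set) module"
  where
  "quotient_module M N =
    \<lparr>carrier = a_rcosets\<^bsub>M\<^esub> N,
     mult = undefined, one = undefined,
     zero = N,
     add = (\<lambda>X Y. X <+>\<^bsub>M\<^esub> Y),
     smult = (\<lambda>c X. \<Union>x\<in>X. N +>\<^bsub>M\<^esub> (c \<odot>\<^bsub>M\<^esub> x))\<rparr>"


section \<open>Tensor products\<close>

definition tensor_relations ::
    "('k, 'r) ring_scheme \<Rightarrow> ('k, 'a, 's) module_scheme \<Rightarrow> ('k, 'b, 't) module_scheme
      \<Rightarrow> ('a \<times> 'b \<Rightarrow> 'k) set"
  where
  "tensor_relations R M N =
    (let F = free_module R (carrier M \<times> carrier N); e = basis_vec R in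
      {e (x \<oplus>\<^bsub>M\<^esub> x', y) \<ominus>\<^bsub>F\<^esub> (e (x, y) \<oplus>\<^bsub>F\<^esub> e (x', y)) | x x' y.
         x \<in> carrier M \<and> x' \<in> carrier M \<and> y \<in> carrier N} \<union>
      {e (x, y \<oplus>\<^bsub>N\<^esub> y') \<ominus>\<^bsub>F\<^esub> (e (x, y) \<oplus>\<^bsub>F\<^esub> e (x, y')) | x y y'.
         x \<in> carrier M \<and> y \<in> carrier N \<and> y' \<in> carrier N} \<union>
      {e (c \<odot>\<^bsub>M\<^esub> x, y) \<ominus>\<^bsub>F\<^esub> c \<odot>\<^bsub>F\<^esub> e (x, y) | c x y.
         c \<in> carrier R \<and> x \<in> carrier M \<and> y \<in> carrier N} \<union>
      {e (x, c \<odot>\<^bsub>N\<^esub> y) \<ominus>\<^bsub>F\<^esub> c \<odot>\<^bsub>F\<^esub> e (x, y) | c x y.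
         c \<in> carrier R \<and> x \<in> carrier M \<and> y \<in> carrier N})"

definition tensor_kernel ::
    "('k, 'r) ring_scheme \<Rightarrow> ('k, 'a, 's) module_scheme \<Rightarrow> ('k, 'b, 't) module_scheme
      \<Rightarrow> ('a \<times> 'b \<Rightarrow> 'k) set"
  where
  "tensor_kernel R M N =
    submodule_generated R (free_module R (carrier M \<times> carrier N)) (tensor_relations R M N)"

definition tensor ::
    "('k, 'r) ring_scheme \<Rightarrow> ('k, 'a, 's) module_scheme \<Rightarrow> ('k, 'b, 't) module_scheme
      \<Rightarrow> ('k, ('a \<times> 'b \<Rightarrow> 'k) set) module"
  where
  "tensor R M N =
    quotient_module (free_module R (carrier M \<times> carrier N)) (tensor_kernel R M N)"

definition pure ::
    "('k, 'r) ring_scheme \<Rightarrow> ('k, 'a, 's) module_scheme \<Rightarrow> ('k, 'b, 't) module_scheme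
      \<Rightarrow> 'a \<Rightarrow> 'b \<Rightarrow> ('a \<times> 'b \<Rightarrow> 'k) set"
  where
  "pure R M N x y =
    tensor_kernel R M N +>\<^bsub>free_module R (carrier M \<times> carrier N)\<^esub> basis_vec R (x, y)"

text \<open>The linear map on the tensor product induced by a bilinear map \<open>\<beta>\<close>, given by the universal
  property. Extensionality only fixes the junk values outside the carrier, so that the map is
  unique as a HOL function.\<close>

definition tensor_lift ::
    "('k, 'r) ring_scheme \<Rightarrow> ('k, 'a, 's) module_scheme \<Rightarrow> ('k, 'b, 't) module_scheme
      \<Rightarrow> ('k, 'c, 'u) module_scheme \<Rightarrow> ('a \<Rightarrow> 'b \<Rightarrow> 'c) \<Rightarrow> ('a \<times> 'b \<Rightarrow> 'k) set \<Rightarrow> 'c"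
  where
  "tensor_lift R M N P \<beta> =
    (THE h. h \<in> linear_maps R (tensor R M N) P \<and> h \<in> extensional (carrier (tensor R M N)) \<and>
      (\<forall>x\<in>carrier M. \<forall>y\<in>carrier N. h (pure R M N x y) = \<beta> x y))"

definition tensor_map ::
    "('k, 'r) ring_scheme \<Rightarrow> ('k, 'a, 's) module_scheme \<Rightarrow> ('k, 'b, 't) module_scheme
      \<Rightarrow> ('k, 'c, 'u) module_scheme \<Rightarrow> ('k, 'd, 'v) module_scheme
      \<Rightarrow> ('a \<Rightarrow> 'c) \<Rightarrow> ('b \<Rightarrow> 'd) \<Rightarrow> ('a \<times> 'b \<Rightarrow> 'k) set \<Rightarrow> ('c \<times> 'd \<Rightarrow> 'k) set"
  where
  "tensor_map R M N M' N' f g =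
    tensor_lift R M N (tensor R M' N') (\<lambda>x y. pure R M' N' (f x) (g y))"

text \<open>The canonical isomorphisms between \<open>(A \<otimes> A) \<otimes> A\<close> and \<open>A \<otimes> (A \<otimes> A)\<close>, usually suppressed
  in informal notation.\<close>

definition assoc_right ::
    "('k, 'r) ring_scheme \<Rightarrow> ('k, 'a, 's) module_scheme
      \<Rightarrow> (('a \<times> 'a \<Rightarrow> 'k) set \<times> 'a \<Rightarrow> 'k) set \<Rightarrow> ('a \<times> ('a \<times> 'a \<Rightarrow> 'k) set \<Rightarrow> 'k) set"
  where
  "assoc_right R A =
    (let AA = tensor R A A; T = tensor R A AA in
      tensor_lift R AA A T
        (\<lambda>t z. tensor_lift R A A T (\<lambda>x y. pure R A AA x (pure R A A y z)) t))"

definition assoc_left ::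
    "('k, 'r) ring_scheme \<Rightarrow> ('k, 'a, 's) module_scheme
      \<Rightarrow> ('a \<times> ('a \<times> 'a \<Rightarrow> 'k) set \<Rightarrow> 'k) set \<Rightarrow> (('a \<times> 'a \<Rightarrow> 'k) set \<times> 'a \<Rightarrow> 'k) set"
  where
  "assoc_left R A =
    (let AA = tensor R A A; T = tensor R AA A in
      tensor_lift R A AA T
        (\<lambda>x t. tensor_lift R A A T (\<lambda>y z. pure R AA A (pure R A A x y) z) t))"


section \<open>Infinitesimal bialgebras\<close>

text \<open>Not the locale \<open>algebra\<close> of \<open>HOL-Algebra\<close>, which requires a commutative multiplication.\<close>

locale unitary_assoc_algebra = module R A + A: ring A
  for R :: "('k, 'r) ring_scheme" and A :: "('k, 'a, 's) module_scheme" +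
  assumes mult_bilinear: "(\<lambda>x y. x \<otimes>\<^bsub>A\<^esub> y) \<in> bilinear_maps R A A A"

definition left_action ::
    "('k, 'r) ring_scheme \<Rightarrow> ('k, 'a, 's) module_scheme
      \<Rightarrow> 'a \<Rightarrow> ('a \<times> 'a \<Rightarrow> 'k) set \<Rightarrow> ('a \<times> 'a \<Rightarrow> 'k) set"
  where
  "left_action R A a t = tensor_lift R A A (tensor R A A) (\<lambda>u v. pure R A A (a \<otimes>\<^bsub>A\<^esub> u) v) t"

definition right_action ::
    "('k, 'r) ring_scheme \<Rightarrow> ('k, 'a, 's) module_scheme
      \<Rightarrow> ('a \<times> 'a \<Rightarrow> 'k) set \<Rightarrow> 'a \<Rightarrow> ('a \<times> 'a \<Rightarrow> 'k) set"
  where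
  "right_action R A t b = tensor_lift R A A (tensor R A A) (\<lambda>u v. pure R A A u (v \<otimes>\<^bsub>A\<^esub> b)) t"

locale unitary_infinitesimal_bialgebra = unitary_assoc_algebra R A
  for R :: "('k, 'r) ring_scheme" and A :: "('k, 'a, 's) module_scheme" +
  fixes \<Delta> :: "'a \<Rightarrow> ('a \<times> 'a \<Rightarrow> 'k) set"
  assumes coproduct_linear: "\<Delta> \<in> linear_maps R A (tensor R A A)"
    and coassociative: "\<And>x. x \<in> carrier A \<Longrightarrow>
      assoc_right R A (tensor_map R A A (tensor R A A) A \<Delta> (\<lambda>a. a) (\<Delta> x)) =
      tensor_map R A A A (tensor R A A) (\<lambda>a. a) \<Delta> (\<Delta> x)"
    and coproduct_mult: "\<And>a b. a \<in> carrier A \<Longrightarrow> b \<in> carrier A \<Longrightarrow>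
      \<Delta> (a \<otimes>\<^bsub>A\<^esub> b) = left_action R A a (\<Delta> b) \<oplus>\<^bsub>tensor R A A\<^esub> right_action R A (\<Delta> a) b"

text \<open>The product of the record \<open>H\<close> is the operation written with a backslash in the literature,
  and \<open>v\<close> is the second operation.\<close>

locale unitary_under_vee_algebra = unitary_assoc_algebra R H
  for R :: "('k, 'r) ring_scheme" and H :: "('k, 'a, 's) module_scheme" +
  fixes v :: "'a \<Rightarrow> 'a \<Rightarrow> 'a"
  assumes vee_bilinear: "v \<in> bilinear_maps R H H H"
    and vee_under: "\<And>x y z. x \<in> carrier H \<Longrightarrow> y \<in> carrier H \<Longrightarrow> z \<in> carrier H \<Longrightarrow>
      v x y \<otimes>\<^bsub>H\<^esub> z = v x (y \<otimes>\<^bsub>H\<^esub> z)"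

text \<open>\<open>x \<otimes> y + (id \<otimes> v)(dx \<otimes> y) + (v \<otimes> id)(x \<otimes> dy)\<close>, where \<open>dx\<close> and \<open>dy\<close> stand for the
  coproducts of \<open>x\<close> and \<open>y\<close>. They are separate arguments because the expression also occurs in the
  recursive definition of the coproduct on trees.\<close>

definition vee_coproduct ::
    "('k, 'r) ring_scheme \<Rightarrow> ('k, 'a, 's) module_scheme \<Rightarrow> ('a \<Rightarrow> 'a \<Rightarrow> 'a)
      \<Rightarrow> 'a \<Rightarrow> ('a \<times> 'a \<Rightarrow> 'k) set \<Rightarrow> 'a \<Rightarrow> ('a \<times> 'a \<Rightarrow> 'k) set \<Rightarrow> ('a \<times> 'a \<Rightarrow> 'k) set"
  where
  "vee_coproduct R H v x dx y dy =
    (let HH = tensor R H H; V = tensor_lift R H H H v in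
      pure R H H x y
      \<oplus>\<^bsub>HH\<^esub> tensor_map R H HH H H (\<lambda>a. a) V (assoc_right R H (pure R HH H dx y))
      \<oplus>\<^bsub>HH\<^esub> tensor_map R HH H H H V (\<lambda>a. a) (assoc_left R H (pure R H HH x dy)))"

locale unitary_infinitesimal_under_vee_bialgebra =
  unitary_under_vee_algebra R H v + unitary_infinitesimal_bialgebra R H \<Delta>
  for R :: "('k, 'r) ring_scheme" and H :: "('k, 'a, 's) module_scheme"
    and \<Delta> :: "'a \<Rightarrow> ('a \<times> 'a \<Rightarrow> 'k) set" and v :: "'a \<Rightarrow> 'a \<Rightarrow> 'a" +
  assumes coproduct_vee: "\<And>x y. x \<in> carrier H \<Longrightarrow> y \<in> carrier H \<Longrightarrow>
      \<Delta> (v x y) = vee_coproduct R H v x (\<Delta> x) y (\<Delta> y)"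


section \<open>Planar binary trees\<close>

datatype pbtree = Trivial | Graft pbtree pbtree

primrec under :: "pbtree \<Rightarrow> pbtree \<Rightarrow> pbtree" where
  "under Trivial T = T"
| "under (Graft Sl Sr) T = Graft Sl (under Sr T)"

definition H_LR :: "('k, 'r) ring_scheme \<Rightarrow> ('k, pbtree \<Rightarrow> 'k) module" where
  "H_LR R =
    (let F = free_module R UNIV in
      F\<lparr>mult := free_lift2 R F (\<lambda>S T. basis_vec R (under S T)), one := basis_vec R Trivial\<rparr>)"

definition vee_LR ::
    "('k, 'r) ring_scheme \<Rightarrow> (pbtree \<Rightarrow> 'k) \<Rightarrow> (pbtree \<Rightarrow> 'k) \<Rightarrow> (pbtree \<Rightarrow> 'k)"
  where
  "vee_LR R = free_lift2 R (H_LR R) (\<lambda>S T. basis_vec R (Graft S T))"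

primrec coproduct_tree ::
    "('k, 'r) ring_scheme \<Rightarrow> pbtree \<Rightarrow> ((pbtree \<Rightarrow> 'k) \<times> (pbtree \<Rightarrow> 'k) \<Rightarrow> 'k) set"
  where
  "coproduct_tree R Trivial = \<zero>\<^bsub>tensor R (H_LR R) (H_LR R)\<^esub>"
| "coproduct_tree R (Graft Tl Tr) =
    vee_coproduct R (H_LR R) (vee_LR R)
      (basis_vec R Tl) (coproduct_tree R Tl) (basis_vec R Tr) (coproduct_tree R Tr)"

definition coproduct_LR ::
    "('k, 'r) ring_scheme \<Rightarrow> (pbtree \<Rightarrow> 'k) \<Rightarrow> ((pbtree \<Rightarrow> 'k) \<times> (pbtree \<Rightarrow> 'k) \<Rightarrow> 'k) set"
  where
  "coproduct_LR R = free_lift R (tensor R (H_LR R) (H_LR R)) (coproduct_tree R)"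

end

theory Submission
  imports Defs
begin

text \<open>
  Everything is linear in each argument, so every axiom needs to be checked on trees only. On trees the
  product is the operation \<open>under\<close>, which is associative with unit the trivial tree by a structural
  induction; that grafting moves past it on the left is its defining equation.

  Write \<open>v\<close> for grafting, \<open>\<Delta> x = x\<^sub>1 \<otimes> x\<^sub>2\<close> and \<open>\<Delta> y = y\<^sub>1 \<otimes> y\<^sub>2\<close> with sums understood.
  The recursion for the coproduct, extended bilinearly (\<open>\<Delta>_vee\<close>), reads
  \<open>\<Delta> (v x y) = x \<otimes> y + x\<^sub>1 \<otimes> v x\<^sub>2 y + v x y\<^sub>1 \<otimes> y\<^sub>2\<close>. Applying it twice gives
  \<open>(\<Delta> \<otimes> id) \<Delta> (v x y)\<close> as the sum of \<open>\<Delta> x \<otimes> y\<close>, \<open>x \<otimes> \<Delta> y\<close>,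
  \<open>x\<^sub>1 \<otimes> v x\<^sub>2 y\<^sub>1 \<otimes> y\<^sub>2\<close>, the tensor \<open>(\<Delta> \<otimes> id) \<Delta> x\<close> with its last factor grafted to \<open>y\<close>,
  and \<open>(\<Delta> \<otimes> id) \<Delta> y\<close> with \<open>x\<close> grafted to its first factor. The other iterate has the same
  summands with \<open>id \<otimes> \<Delta>\<close> in the last two. Hence coassociativity passes from two trees to their grafting
  (\<open>coassociative_v\<close>), and it holds at the trivial tree, where the coproduct vanishes. In the same way the
  law for the coproduct of a product passes from \<open>y\<close>, \<open>z\<close> to \<open>v x y\<close>, \<open>z\<close>
  (\<open>coproduct_mult_v\<close>), and it holds when the left factor is the trivial tree.

  The remaining work is the linear algebra behind these notations: the quotient of the free module really
  has the universal property of the tensor product (\<open>tensor_lift\<close>), and linear maps on it agree as soon as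
  they agree on pure tensors (\<open>tensor_ext\<close>).
\<close>

section \<open>Linear and bilinear maps\<close>

lemma linear_mapsI:
  assumes "\<And>x. x \<in> carrier M \<Longrightarrow> f x \<in> carrier N"
    and "\<And>x y. x \<in> carrier M \<Longrightarrow> y \<in> carrier M \<Longrightarrow> f (x \<oplus>\<^bsub>M\<^esub> y) = f x \<oplus>\<^bsub>N\<^esub> f y"
    and "\<And>c x. c \<in> carrier R \<Longrightarrow> x \<in> carrier M \<Longrightarrow> f (c \<odot>\<^bsub>M\<^esub> x) = c \<odot>\<^bsub>N\<^esub> f x"
  shows "f \<in> linear_maps R M N"
  using assms by (auto simp: linear_maps_def)

lemma linear_mapsD:
  assumes "f \<in> linear_maps R M N"
  shows "x \<in> carrier M \<Longrightarrow> f x \<in> carrier N"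
    and "x \<in> carrier M \<Longrightarrow> y \<in> carrier M \<Longrightarrow> f (x \<oplus>\<^bsub>M\<^esub> y) = f x \<oplus>\<^bsub>N\<^esub> f y"
    and "c \<in> carrier R \<Longrightarrow> x \<in> carrier M \<Longrightarrow> f (c \<odot>\<^bsub>M\<^esub> x) = c \<odot>\<^bsub>N\<^esub> f x"
  using assms by (auto simp: linear_maps_def)

lemma bilinear_mapsI:
  assumes "\<And>x. x \<in> carrier M \<Longrightarrow> (\<lambda>y. \<beta> x y) \<in> linear_maps R N P"
    and "\<And>y. y \<in> carrier N \<Longrightarrow> (\<lambda>x. \<beta> x y) \<in> linear_maps R M P"
  shows "\<beta> \<in> bilinear_maps R M N P"
  using assms by (auto simp: bilinear_maps_def)

lemma bilinear_mapsD:
  assumes "\<beta> \<in> bilinear_maps R M N P"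
  shows "x \<in> carrier M \<Longrightarrow> (\<lambda>y. \<beta> x y) \<in> linear_maps R N P"
    and "y \<in> carrier N \<Longrightarrow> (\<lambda>x. \<beta> x y) \<in> linear_maps R M P"
  using assms by (auto simp: bilinear_maps_def)

lemma bilinear_maps_closed:
  assumes "\<beta> \<in> bilinear_maps R M N P" "x \<in> carrier M" "y \<in> carrier N"
  shows "\<beta> x y \<in> carrier P"
  using assms by (auto simp: bilinear_maps_def linear_maps_def Pi_iff)

lemma linear_maps_id: "(\<lambda>x. x) \<in> linear_maps R M M"
  by (auto simp: linear_maps_def)

lemma linear_maps_comp:
  assumes "g \<in> linear_maps R N P" "f \<in> linear_maps R M N"
  shows "(\<lambda>x. g (f x)) \<in> linear_maps R M P"
  using assms by (auto simp: linear_maps_def Pi_iff)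

lemma linear_maps_plus:
  assumes "module R N" "f \<in> linear_maps R M N" "g \<in> linear_maps R M N"
  shows "(\<lambda>x. f x \<oplus>\<^bsub>N\<^esub> g x) \<in> linear_maps R M N"
proof -
  interpret N: module R N by fact
  show ?thesis
    by (rule linear_mapsI)
      (simp_all add: linear_mapsD[OF assms(2)] linear_mapsD[OF assms(3)] N.smult_r_distr N.M.a_ac)
qed

lemma linear_maps_smult:
  assumes "module R N" "c \<in> carrier R"
  shows "(\<lambda>x. c \<odot>\<^bsub>N\<^esub> x) \<in> linear_maps R N N"
proof -
  interpret N: module R N by fact
  show ?thesis
    by (rule linear_mapsI) (use assms(2) in \<open>simp_all add: N.smult_r_distr N.R.m_comm flip: N.smult_assoc1\<close>)
qed

lemma linear_maps_zero:
  assumes "module R M" "module R N" "f \<in> linear_maps R M N"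
  shows "f \<zero>\<^bsub>M\<^esub> = \<zero>\<^bsub>N\<^esub>"
proof -
  interpret M: module R M by fact
  interpret N: module R N by fact
  \<comment> \<open>Homogeneity for the zero scalar suffices.\<close>
  have "f (\<zero>\<^bsub>R\<^esub> \<odot>\<^bsub>M\<^esub> \<zero>\<^bsub>M\<^esub>) = \<zero>\<^bsub>R\<^esub> \<odot>\<^bsub>N\<^esub> f \<zero>\<^bsub>M\<^esub>"
    by (simp add: linear_mapsD[OF assms(3)] del: M.smult_l_null M.smult_r_null N.smult_l_null)
  then show ?thesis by (simp add: linear_mapsD[OF assms(3)])
qed

lemma linear_maps_minus:
  assumes "module R M" "module R N" "f \<in> linear_maps R M N" "x \<in> carrier M" "y \<in> carrier M"
  shows "f (x \<ominus>\<^bsub>M\<^esub> y) = f x \<ominus>\<^bsub>N\<^esub> f y"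
proof -
  interpret M: module R M by fact
  interpret N: module R N by fact
  note f = linear_mapsD[OF assms(3)]
  have "f (x \<ominus>\<^bsub>M\<^esub> y) \<oplus>\<^bsub>N\<^esub> f y = f x"
    using assms(4,5)
    by (simp add: f(2)[symmetric] a_minus_def M.M.a_assoc M.M.l_neg)
  then show ?thesis
    using assms(4,5) f(1) by (metis M.M.minus_closed a_minus_def N.M.add.inv_solve_right)
qed

lemma (in module) minus_eq_zero_iff:
  assumes "x \<in> carrier M" "y \<in> carrier M"
  shows "x \<ominus>\<^bsub>M\<^esub> y = \<zero>\<^bsub>M\<^esub> \<longleftrightarrow> x = y"
  using assms by (metis a_minus_def M.add.inv_closed M.add.inv_inv M.add.r_inv M.minus_equality)

lemma kernel_submodule:
  assumes "module R M" "module R N" "f \<in> linear_maps R M N"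
  shows "submodule {x \<in> carrier M. f x = \<zero>\<^bsub>N\<^esub>} R M"
proof -
  interpret M: module R M by fact
  interpret N: module R N by fact
  note f = linear_mapsD[OF assms(3)]
  have "f (\<ominus>\<^bsub>M\<^esub> a) = \<zero>\<^bsub>N\<^esub>" if "a \<in> carrier M" "f a = \<zero>\<^bsub>N\<^esub>" for a
    using linear_maps_minus[OF assms M.M.zero_closed that(1)] that
      linear_maps_zero[OF assms] by (simp add: a_minus_def)
  then show ?thesis
    by (intro M.submoduleI) (auto simp: f linear_maps_zero[OF assms])
qed

lemma bilinear_maps_comp:
  assumes "h \<in> linear_maps R P Q" "\<beta> \<in> bilinear_maps R M N P"
  shows "(\<lambda>x y. h (\<beta> x y)) \<in> bilinear_maps R M N Q"
  by (intro bilinear_mapsI linear_maps_comp[OF assms(1)] bilinear_mapsD[OF assms(2)])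

lemma bilinear_maps_precomp:
  assumes "\<beta> \<in> bilinear_maps R M N P" "f \<in> linear_maps R M' M" "g \<in> linear_maps R N' N"
  shows "(\<lambda>x y. \<beta> (f x) (g y)) \<in> bilinear_maps R M' N' P"
  by (intro bilinear_mapsI linear_maps_comp[OF _ assms(2)] linear_maps_comp[OF _ assms(3)]
      bilinear_mapsD[OF assms(1)] linear_mapsD(1)[OF assms(2)] linear_mapsD(1)[OF assms(3)])

lemma bilinear_maps_plus:
  assumes "module R P" "\<beta> \<in> bilinear_maps R M N P" "\<gamma> \<in> bilinear_maps R M N P"
  shows "(\<lambda>x y. \<beta> x y \<oplus>\<^bsub>P\<^esub> \<gamma> x y) \<in> bilinear_maps R M N P"
  by (intro bilinear_mapsI linear_maps_plus[OF assms(1)] bilinear_mapsD[OF assms(2)]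
      bilinear_mapsD[OF assms(3)])

lemma bilinear_maps_flip:
  "\<beta> \<in> bilinear_maps R M N P \<Longrightarrow> (\<lambda>y x. \<beta> x y) \<in> bilinear_maps R N M P"
  by (auto simp: bilinear_maps_def)


section \<open>Free modules\<close>

lemma free_module_simps:
  "carrier (free_module R S) = {f. (\<forall>s. f s \<in> carrier R) \<and> (\<forall>s. s \<notin> S \<longrightarrow> f s = \<zero>\<^bsub>R\<^esub>) \<and> finite {s. f s \<noteq> \<zero>\<^bsub>R\<^esub>}}"
  "zero (free_module R S) = (\<lambda>s. \<zero>\<^bsub>R\<^esub>)"
  "add (free_module R S) = (\<lambda>f g s. f s \<oplus>\<^bsub>R\<^esub> g s)"
  "smult (free_module R S) = (\<lambda>c f s. c \<otimes>\<^bsub>R\<^esub> f s)"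
  by (simp_all add: free_module_def)

context
  notes free_module_simps [simp]
begin

lemma free_module_module:
  assumes "cring R"
  shows "module R (free_module R S)"
proof -
  interpret R: cring R by fact
  have neg: "\<ominus>\<^bsub>R\<^esub> \<zero>\<^bsub>R\<^esub> = \<zero>\<^bsub>R\<^esub>" by simp
  show ?thesis
  proof (intro moduleI abelian_groupI)
    fix f g assume f: "f \<in> carrier (free_module R S)" and g: "g \<in> carrier (free_module R S)"
    then have "finite ({s. f s \<noteq> \<zero>\<^bsub>R\<^esub>} \<union> {s. g s \<noteq> \<zero>\<^bsub>R\<^esub>})" by simp
    then have "finite {s. f s \<oplus>\<^bsub>R\<^esub> g s \<noteq> \<zero>\<^bsub>R\<^esub>}"
      by (rule rev_finite_subset) auto
    with f g show "f \<oplus>\<^bsub>free_module R S\<^esub> g \<in> carrier (free_module R S)" by simp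
  next
    fix f assume f: "f \<in> carrier (free_module R S)"
    then have "finite {s. f s \<noteq> \<zero>\<^bsub>R\<^esub>}" by simp
    then have "finite {s. \<ominus>\<^bsub>R\<^esub> f s \<noteq> \<zero>\<^bsub>R\<^esub>}"
      by (rule rev_finite_subset) auto
    with f show "\<exists>g\<in>carrier (free_module R S). g \<oplus>\<^bsub>free_module R S\<^esub> f = \<zero>\<^bsub>free_module R S\<^esub>"
      by (intro bexI[of _ "\<lambda>s. \<ominus>\<^bsub>R\<^esub> f s"]) (auto simp: R.l_neg)
  next
    fix c f assume c: "c \<in> carrier R" and f: "f \<in> carrier (free_module R S)"
    then have "finite {s. f s \<noteq> \<zero>\<^bsub>R\<^esub>}" by simp
    then have "finite {s. c \<otimes>\<^bsub>R\<^esub> f s \<noteq> \<zero>\<^bsub>R\<^esub>}"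
      by (rule rev_finite_subset) (use c in auto)
    with c f show "c \<odot>\<^bsub>free_module R S\<^esub> f \<in> carrier (free_module R S)" by simp
  qed (auto simp: assms R.a_ac R.m_assoc R.l_distr R.r_distr)
qed

lemma basis_vec_closed [simp]:
  assumes "cring R" "s \<in> S"
  shows "basis_vec R s \<in> carrier (free_module R S)"
proof -
  interpret R: cring R by fact
  have "finite {t. basis_vec R s t \<noteq> \<zero>\<^bsub>R\<^esub>}"
    by (rule finite_subset[of _ "{s}"]) (auto simp: basis_vec_def)
  then show ?thesis using assms(2) by (auto simp: basis_vec_def)
qed

text \<open>The sum defining \<open>free_lift\<close> runs over the support of its argument. Linearity compares the supports
  of \<open>f\<close>, \<open>g\<close> and \<open>f + g\<close>, which is possible once all the sums run over one common index set.\<close>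

lemma free_lift_superset:
  assumes "module R P" "\<phi> \<in> S \<rightarrow> carrier P" "f \<in> carrier (free_module R S)"
    and "finite A" "A \<subseteq> S" "{s. f s \<noteq> \<zero>\<^bsub>R\<^esub>} \<subseteq> A"
  shows "free_lift R P \<phi> f = (\<Oplus>\<^bsub>P\<^esub>s\<in>A. f s \<odot>\<^bsub>P\<^esub> \<phi> s)"
proof -
  interpret P: module R P by fact
  show ?thesis unfolding free_lift_def
    by (rule P.M.add.finprod_mono_neutral_cong_left) (use assms in \<open>auto simp: Pi_iff\<close>)
qed

lemma free_lift_linear:
  assumes "module R P" "\<phi> \<in> S \<rightarrow> carrier P"
  shows "free_lift R P \<phi> \<in> linear_maps R (free_module R S) P"
proof -
  interpret P: module R P by fact
  interpret F: module R "free_module R S" by (rule free_module_module) (rule P.R.is_cring)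
  note sup = free_lift_superset[OF assms]
  show ?thesis
  proof (rule linear_mapsI)
    fix f assume f: "f \<in> carrier (free_module R S)"
    then show "free_lift R P \<phi> f \<in> carrier P"
      unfolding free_lift_def using assms by (intro P.M.finsum_closed) (auto simp: Pi_iff)
  next
    fix f g assume f: "f \<in> carrier (free_module R S)" and g: "g \<in> carrier (free_module R S)"
    define A where "A = {s. f s \<noteq> \<zero>\<^bsub>R\<^esub>} \<union> {s. g s \<noteq> \<zero>\<^bsub>R\<^esub>}"
    have A: "finite A" "A \<subseteq> S" using f g by (auto simp: A_def)
    have phi: "s \<in> A \<Longrightarrow> \<phi> s \<in> carrier P" for s using A assms by auto
    have eq: "(\<Oplus>\<^bsub>P\<^esub>s\<in>A. (f s \<oplus>\<^bsub>R\<^esub> g s) \<odot>\<^bsub>P\<^esub> \<phi> s)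
        = (\<Oplus>\<^bsub>P\<^esub>s\<in>A. f s \<odot>\<^bsub>P\<^esub> \<phi> s \<oplus>\<^bsub>P\<^esub> g s \<odot>\<^bsub>P\<^esub> \<phi> s)"
      by (rule P.M.finsum_cong') (use f g phi in \<open>auto simp: P.smult_l_distr\<close>)
    show "free_lift R P \<phi> (f \<oplus>\<^bsub>free_module R S\<^esub> g) = free_lift R P \<phi> f \<oplus>\<^bsub>P\<^esub> free_lift R P \<phi> g"
      using f g phi eq
      by (subst (1 2 3) sup[OF _ A])
        (use F.M.a_closed[OF f g] in \<open>auto simp: A_def Pi_iff P.M.finsum_addf\<close>)
  next
    fix c f assume c: "c \<in> carrier R" and f: "f \<in> carrier (free_module R S)"
    define A where "A = {s. f s \<noteq> \<zero>\<^bsub>R\<^esub>}"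
    have A: "finite A" "A \<subseteq> S" using f by (auto simp: A_def)
    have phi: "s \<in> A \<Longrightarrow> \<phi> s \<in> carrier P" for s using A assms by auto
    have eq: "(\<Oplus>\<^bsub>P\<^esub>s\<in>A. (c \<otimes>\<^bsub>R\<^esub> f s) \<odot>\<^bsub>P\<^esub> \<phi> s)
        = (\<Oplus>\<^bsub>P\<^esub>s\<in>A. c \<odot>\<^bsub>P\<^esub> (f s \<odot>\<^bsub>P\<^esub> \<phi> s))"
      by (rule P.M.finsum_cong') (use c f phi in \<open>auto simp: P.smult_assoc1\<close>)
    show "free_lift R P \<phi> (c \<odot>\<^bsub>free_module R S\<^esub> f) = c \<odot>\<^bsub>P\<^esub> free_lift R P \<phi> f"
      using c f phi eq A
      by (subst (1 2) sup[OF _ A])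
        (use F.smult_closed[OF c f] in \<open>auto simp: A_def Pi_iff P.finsum_smult_ldistr\<close>)
  qed
qed

lemma free_lift_basis_vec [simp]:
  assumes "module R P" "\<phi> s \<in> carrier P"
  shows "free_lift R P \<phi> (basis_vec R s) = \<phi> s"
proof -
  interpret P: module R P by fact
  have "free_lift R P \<phi> (basis_vec R s) = (\<Oplus>\<^bsub>P\<^esub>t\<in>{s}. basis_vec R s t \<odot>\<^bsub>P\<^esub> \<phi> t)"
    by (rule free_lift_superset[where S = "{s}"])
      (use assms P.R.is_cring in \<open>auto simp: basis_vec_def\<close>)
  then show ?thesis using assms by (simp add: P.M.finsum_insert basis_vec_def)
qed

text \<open>The argument is an induction over a finite set that contains the support of \<open>f\<close>: one coordinate of
  \<open>f\<close> is split off as a multiple of a basis vector.\<close>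

lemma free_module_ext:
  assumes "cring R" "module R P"
    and g: "g \<in> linear_maps R (free_module R S) P" and h: "h \<in> linear_maps R (free_module R S) P"
    and basis: "\<And>s. s \<in> S \<Longrightarrow> g (basis_vec R s) = h (basis_vec R s)"
    and "f \<in> carrier (free_module R S)"
  shows "g f = h f"
proof -
  interpret R: cring R by fact
  interpret F: module R "free_module R S" by (rule free_module_module) fact
  have "g f = h f" if "finite A" "f \<in> carrier (free_module R S)" "{s. f s \<noteq> \<zero>\<^bsub>R\<^esub>} \<subseteq> A" for A f
    using that
  proof (induction A arbitrary: f)
    case empty
    then have "f = \<zero>\<^bsub>free_module R S\<^esub>" by auto
    then show ?case
      using linear_maps_zero[OF F.module_axioms assms(2)] g h by metis
  next
    case (insert a A)
    show ?case
    proof (cases "a \<in> S")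
      case False
      then have "f a = \<zero>\<^bsub>R\<^esub>" using insert.prems by simp
      then show ?thesis using insert.prems by (intro insert.IH) auto
    next
      case True
      define f' where "f' = f(a := \<zero>\<^bsub>R\<^esub>)"
      have "finite {s. f' s \<noteq> \<zero>\<^bsub>R\<^esub>}"
        by (rule finite_subset[of _ "{s. f s \<noteq> \<zero>\<^bsub>R\<^esub>}"]) (use insert.prems in \<open>auto simp: f'_def\<close>)
      then have f': "f' \<in> carrier (free_module R S)" using insert.prems by (auto simp: f'_def)
      have eq: "f = f' \<oplus>\<^bsub>free_module R S\<^esub> f a \<odot>\<^bsub>free_module R S\<^esub> basis_vec R a"
        using insert.prems by (auto simp: f'_def basis_vec_def)
      have "g f' = h f'" using f' insert.prems by (intro insert.IH) (auto simp: f'_def)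
      moreover have split: "k f = k f' \<oplus>\<^bsub>P\<^esub> f a \<odot>\<^bsub>P\<^esub> k (basis_vec R a)"
        if k: "k \<in> linear_maps R (free_module R S) P" for k
      proof -
        have a: "f a \<in> carrier R" using insert.prems by simp
        note e = basis_vec_closed[OF assms(1) True]
        have "k f = k (f' \<oplus>\<^bsub>free_module R S\<^esub> f a \<odot>\<^bsub>free_module R S\<^esub> basis_vec R a)"
          using eq by (rule arg_cong)
        also have "\<dots> = k f' \<oplus>\<^bsub>P\<^esub> f a \<odot>\<^bsub>P\<^esub> k (basis_vec R a)"
          unfolding linear_mapsD(2)[OF k f' F.smult_closed[OF a e]] linear_mapsD(3)[OF k a e] ..
        finally show ?thesis .
      qed
      ultimately show ?thesis by (simp add: split[OF g] split[OF h] basis[OF True])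
    qed
  qed
  from this[of "{s. f s \<noteq> \<zero>\<^bsub>R\<^esub>}" f] show ?thesis using assms(6) by simp
qed


end

lemma bilinear_free_ext:
  assumes "cring R" "module R P"
    and \<beta>: "\<beta> \<in> bilinear_maps R (free_module R S) (free_module R T) P"
    and \<gamma>: "\<gamma> \<in> bilinear_maps R (free_module R S) (free_module R T) P"
    and basis: "\<And>s t. s \<in> S \<Longrightarrow> t \<in> T \<Longrightarrow>
      \<beta> (basis_vec R s) (basis_vec R t) = \<gamma> (basis_vec R s) (basis_vec R t)"
    and f: "f \<in> carrier (free_module R S)" and g: "g \<in> carrier (free_module R T)"
  shows "\<beta> f g = \<gamma> f g"
proof (rule free_module_ext[OF assms(1,2) bilinear_mapsD(2)[OF \<beta> g] bilinear_mapsD(2)[OF \<gamma> g] _ f])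
  fix s assume "s \<in> S"
  then have s: "basis_vec R s \<in> carrier (free_module R S)" using assms(1) by simp
  show "\<beta> (basis_vec R s) g = \<gamma> (basis_vec R s) g"
    by (rule free_module_ext[OF assms(1,2) bilinear_mapsD(1)[OF \<beta> s] bilinear_mapsD(1)[OF \<gamma> s] _ g])
      (simp add: basis \<open>s \<in> S\<close>)
qed

text \<open>Linearity in the first argument is linearity of a \<open>free_lift\<close>. In the second argument it holds when
  the first one is a basis vector, and then in general, since both sides of the additivity and homogeneity
  equations are linear in the first argument.\<close>

lemma free_lift2_bilinear:
  assumes "module R P" "\<And>s t. s \<in> S \<Longrightarrow> t \<in> S \<Longrightarrow> \<phi> s t \<in> carrier P"
  shows "free_lift2 R P \<phi> \<in> bilinear_maps R (free_module R S) (free_module R S) P"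
    and "s \<in> S \<Longrightarrow> t \<in> S \<Longrightarrow> free_lift2 R P \<phi> (basis_vec R s) (basis_vec R t) = \<phi> s t"
proof -
  interpret P: module R P by fact
  let ?F = "free_module R S"
  interpret F: module R ?F by (rule free_module_module[OF P.R.is_cring])
  have inner: "free_lift R P (\<phi> s) \<in> linear_maps R ?F P" if "s \<in> S" for s
    by (rule free_lift_linear) (use assms that in auto)
  have outer: "(\<lambda>s. free_lift R P (\<phi> s) g) \<in> S \<rightarrow> carrier P" if "g \<in> carrier ?F" for g
    using linear_mapsD(1)[OF inner] that by blast
  have lin: "free_lift2 R P \<phi> f \<in> linear_maps R ?F P" if f: "f \<in> carrier ?F" for f
  proof (rule linear_mapsI)
    note l = free_lift_linear[OF assms(1) outer]
    fix g assume g: "g \<in> carrier ?F"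
    show "free_lift2 R P \<phi> f g \<in> carrier P"
      unfolding free_lift2_def by (rule linear_mapsD(1)[OF l[OF g] f])
    fix h assume h: "h \<in> carrier ?F"
    show "free_lift2 R P \<phi> f (g \<oplus>\<^bsub>?F\<^esub> h) = free_lift2 R P \<phi> f g \<oplus>\<^bsub>P\<^esub> free_lift2 R P \<phi> f h"
      unfolding free_lift2_def
    proof (rule free_module_ext[OF P.R.is_cring assms(1) l linear_maps_plus[OF assms(1) l l] _ f])
      fix s assume s: "s \<in> S"
      note c = F.M.a_closed[OF g h]
      show "free_lift R P (\<lambda>s. free_lift R P (\<phi> s) (g \<oplus>\<^bsub>?F\<^esub> h)) (basis_vec R s)
        = free_lift R P (\<lambda>s. free_lift R P (\<phi> s) g) (basis_vec R s)
          \<oplus>\<^bsub>P\<^esub> free_lift R P (\<lambda>s. free_lift R P (\<phi> s) h) (basis_vec R s)"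
        by (subst (1 2 3) free_lift_basis_vec[OF assms(1)])
          (rule linear_mapsD[OF inner[OF s]] g h c)+
    qed (use g h in simp_all)
  next
    note l = free_lift_linear[OF assms(1) outer]
    fix c g assume c: "c \<in> carrier R" and g: "g \<in> carrier ?F"
    note l' = linear_maps_comp[OF linear_maps_smult[OF assms(1) c] l[OF g]]
    show "free_lift2 R P \<phi> f (c \<odot>\<^bsub>?F\<^esub> g) = c \<odot>\<^bsub>P\<^esub> free_lift2 R P \<phi> f g"
      unfolding free_lift2_def
    proof (rule free_module_ext[OF P.R.is_cring assms(1) l l' _ f])
      fix s assume s: "s \<in> S"
      note cg = F.smult_closed[OF c g]
      show "free_lift R P (\<lambda>s. free_lift R P (\<phi> s) (c \<odot>\<^bsub>?F\<^esub> g)) (basis_vec R s)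
        = c \<odot>\<^bsub>P\<^esub> free_lift R P (\<lambda>s. free_lift R P (\<phi> s) g) (basis_vec R s)"
        by (subst (1 2) free_lift_basis_vec[OF assms(1)])
          (rule linear_mapsD[OF inner[OF s]] c g cg)+
    qed (use c g in simp_all)
  qed
  show "free_lift2 R P \<phi> \<in> bilinear_maps R ?F ?F P"
  proof (rule bilinear_mapsI[OF lin])
    show "(\<lambda>f. free_lift2 R P \<phi> f g) \<in> linear_maps R ?F P" if "g \<in> carrier ?F" for g
      unfolding free_lift2_def using free_lift_linear[OF assms(1) outer[OF that]] .
  qed
  show "free_lift2 R P \<phi> (basis_vec R s) (basis_vec R t) = \<phi> s t" if "s \<in> S" "t \<in> S"
    using assms that by (simp add: free_lift2_def)
qed


section \<open>Quotient modules\<close>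

lemma (in module) submodule_generated_submodule:
  assumes "X \<subseteq> carrier M"
  shows "submodule (submodule_generated R M X) R M"
proof -
  have "submodule_generated R M X \<subseteq> carrier M"
    using assms carrier_is_submodule by (auto simp: submodule_generated_def)
  moreover have "\<zero>\<^bsub>M\<^esub> \<in> N" if "submodule N R M" for N
    using subgroup.one_closed[OF submodule.axioms(1)[OF that]] by simp
  ultimately show ?thesis
    by (intro submoduleI) (simp_all add: submodule_generated_def submoduleE)
qed

lemma submodule_generated_superset: "X \<subseteq> submodule_generated R M X"
  by (auto simp: submodule_generated_def)

lemma submodule_generated_least:
  assumes "submodule N R M" "X \<subseteq> N"
  shows "submodule_generated R M X \<subseteq> N"
  using assms by (auto simp: submodule_generated_def)


locale quotient_of_module = module R M for R :: "('k, 'r) ring_scheme" and M :: "('k, 'a, 's) module_scheme" +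
  fixes N
  assumes submodule_N: "submodule N R M"
begin

sublocale abelian_subgroup N M
proof (rule abelian_subgroupI3)
  show "additive_subgroup N M"
    using submodule_N by (intro additive_subgroupI) (simp add: submodule_def)
qed (rule M.abelian_group_axioms)

abbreviation "Q \<equiv> quotient_module M N"

lemma coset_eq_iff:
  assumes "x \<in> carrier M" "y \<in> carrier M"
  shows "N +>\<^bsub>M\<^esub> x = N +>\<^bsub>M\<^esub> y \<longleftrightarrow> x \<ominus>\<^bsub>M\<^esub> y \<in> N"
  unfolding a_minus_def using assms a_rcos_module a_rcos_self M.a_repr_independence a_subgroup
  by metis

lemma quotient_simps:
  shows "carrier Q = (\<lambda>x. N +>\<^bsub>M\<^esub> x) ` carrier M"
    and "\<zero>\<^bsub>Q\<^esub> = N +>\<^bsub>M\<^esub> \<zero>\<^bsub>M\<^esub>"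
    and "x \<in> carrier M \<Longrightarrow> y \<in> carrier M \<Longrightarrow>
      (N +>\<^bsub>M\<^esub> x) \<oplus>\<^bsub>Q\<^esub> (N +>\<^bsub>M\<^esub> y) = N +>\<^bsub>M\<^esub> (x \<oplus>\<^bsub>M\<^esub> y)"
  by (auto simp: quotient_module_def A_RCOSETS_def' a_rcos_sum a_subset)

text \<open>The scalar multiple of a coset is defined as a union of cosets, one for each representative; they all
  coincide because \<open>N\<close> is closed under scalar multiplication.\<close>

lemma quotient_smult:
  assumes "c \<in> carrier R" "x \<in> carrier M"
  shows "c \<odot>\<^bsub>Q\<^esub> (N +>\<^bsub>M\<^esub> x) = N +>\<^bsub>M\<^esub> (c \<odot>\<^bsub>M\<^esub> x)"
proof -
  have "N +>\<^bsub>M\<^esub> (c \<odot>\<^bsub>M\<^esub> y) = N +>\<^bsub>M\<^esub> (c \<odot>\<^bsub>M\<^esub> x)" if "y \<in> N +>\<^bsub>M\<^esub> x" for y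
  proof -
    have y: "y \<in> carrier M" using assms(2) that by (rule a_elemrcos_carrier)
    have "y \<ominus>\<^bsub>M\<^esub> x \<in> N"
      using that assms(2) y a_rcos_module by (simp add: a_minus_def)
    then have "c \<odot>\<^bsub>M\<^esub> (y \<ominus>\<^bsub>M\<^esub> x) \<in> N" using assms(1) submoduleE(4)[OF submodule_N] by blast
    then show ?thesis using y assms
      by (subst coset_eq_iff) (simp_all add: a_minus_def smult_r_distr smult_r_minus)
  qed
  then have "(\<Union>y\<in>N +>\<^bsub>M\<^esub> x. N +>\<^bsub>M\<^esub> (c \<odot>\<^bsub>M\<^esub> y)) = (\<Union>y\<in>N +>\<^bsub>M\<^esub> x. N +>\<^bsub>M\<^esub> (c \<odot>\<^bsub>M\<^esub> x))"
    by (rule SUP_cong[OF refl])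
  moreover have "x \<in> N +>\<^bsub>M\<^esub> x" using assms(2) by (rule a_rcos_self)
  then have "(\<Union>y\<in>N +>\<^bsub>M\<^esub> x. N +>\<^bsub>M\<^esub> (c \<odot>\<^bsub>M\<^esub> x)) = N +>\<^bsub>M\<^esub> (c \<odot>\<^bsub>M\<^esub> x)" by blast
  ultimately show ?thesis by (simp add: quotient_module_def)
qed

lemma quotient_module_module: "module R Q"
proof (rule moduleI[OF R.is_cring], rule abelian_groupI)
  show "\<exists>y\<in>carrier Q. y \<oplus>\<^bsub>Q\<^esub> x = \<zero>\<^bsub>Q\<^esub>" if "x \<in> carrier Q" for x
  proof -
    from that obtain a where a: "a \<in> carrier M" "x = N +>\<^bsub>M\<^esub> a" by (auto simp: quotient_simps)
    then show ?thesis
      by (intro bexI[of _ "N +>\<^bsub>M\<^esub> (\<ominus>\<^bsub>M\<^esub> a)"]) (simp_all add: quotient_simps M.l_neg)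
  qed
qed (auto simp: quotient_simps quotient_smult M.a_ac smult_l_distr smult_r_distr smult_assoc1)

lemma quotient_proj_linear: "(\<lambda>x. N +>\<^bsub>M\<^esub> x) \<in> linear_maps R M Q"
  by (rule linear_mapsI) (auto simp: quotient_simps quotient_smult)

text \<open>The induced map takes the value of \<open>f\<close> at a chosen representative of the coset. Two representatives
  differ by an element of \<open>N\<close>, where \<open>f\<close> vanishes, so the choice does not matter.\<close>

lemma quotient_lift:
  assumes "module R P" "f \<in> linear_maps R M P" "\<And>x. x \<in> N \<Longrightarrow> f x = \<zero>\<^bsub>P\<^esub>"
  shows "\<exists>h\<in>linear_maps R Q P. \<forall>x\<in>carrier M. h (N +>\<^bsub>M\<^esub> x) = f x"
proof -
  interpret P: module R P by fact
  define h where "h X = f (SOME x. x \<in> carrier M \<and> X = N +>\<^bsub>M\<^esub> x)" for X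
  have h: "h (N +>\<^bsub>M\<^esub> x) = f x" if x: "x \<in> carrier M" for x
  proof -
    define y where "y = (SOME y. y \<in> carrier M \<and> N +>\<^bsub>M\<^esub> x = N +>\<^bsub>M\<^esub> y)"
    have y: "y \<in> carrier M" "N +>\<^bsub>M\<^esub> x = N +>\<^bsub>M\<^esub> y"
      using someI[of "\<lambda>y. y \<in> carrier M \<and> N +>\<^bsub>M\<^esub> x = N +>\<^bsub>M\<^esub> y" x] x by (simp_all add: y_def)
    then have "f (x \<ominus>\<^bsub>M\<^esub> y) = \<zero>\<^bsub>P\<^esub>" using x assms(3) coset_eq_iff by blast
    then have "f x = f y"
      using x y linear_maps_minus[OF module_axioms assms(1,2)] P.minus_eq_zero_iff
        linear_mapsD(1)[OF assms(2)] by metis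
    then show ?thesis by (simp add: h_def y_def)
  qed
  have "h \<in> linear_maps R Q P"
    by (rule linear_mapsI)
      (auto simp: quotient_simps quotient_smult h linear_mapsD[OF assms(2)])
  then show ?thesis using h by blast
qed

end


section \<open>Tensor products\<close>

locale tensor_product = M: module R M + N: module R N
  for R :: "('k, 'r) ring_scheme" and M :: "('k, 'a, 's) module_scheme"
    and N :: "('k, 'b, 't) module_scheme"
begin

abbreviation "F \<equiv> free_module R (carrier M \<times> carrier N)"
abbreviation "K \<equiv> tensor_kernel R M N"
abbreviation "e \<equiv> basis_vec R"

sublocale F: module R F
  by (rule free_module_module) (rule M.R.is_cring)

lemma e_closed [simp]:
  "x \<in> carrier M \<Longrightarrow> y \<in> carrier N \<Longrightarrow> e (x, y) \<in> carrier F"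
  by (rule basis_vec_closed) (auto intro: M.R.is_cring)

lemma tensor_relations_cases [consumes 1]:
  assumes "z \<in> tensor_relations R M N"
  obtains
    x x' y where "z = e (x \<oplus>\<^bsub>M\<^esub> x', y) \<ominus>\<^bsub>F\<^esub> (e (x, y) \<oplus>\<^bsub>F\<^esub> e (x', y))"
      "x \<in> carrier M" "x' \<in> carrier M" "y \<in> carrier N"
  | x y y' where "z = e (x, y \<oplus>\<^bsub>N\<^esub> y') \<ominus>\<^bsub>F\<^esub> (e (x, y) \<oplus>\<^bsub>F\<^esub> e (x, y'))"
      "x \<in> carrier M" "y \<in> carrier N" "y' \<in> carrier N"
  | c x y where "z = e (c \<odot>\<^bsub>M\<^esub> x, y) \<ominus>\<^bsub>F\<^esub> c \<odot>\<^bsub>F\<^esub> e (x, y)"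
      "c \<in> carrier R" "x \<in> carrier M" "y \<in> carrier N"
  | c x y where "z = e (x, c \<odot>\<^bsub>N\<^esub> y) \<ominus>\<^bsub>F\<^esub> c \<odot>\<^bsub>F\<^esub> e (x, y)"
      "c \<in> carrier R" "x \<in> carrier M" "y \<in> carrier N"
  using assms unfolding tensor_relations_def Let_def by blast

lemma tensor_relations_intros:
  shows "x \<in> carrier M \<Longrightarrow> x' \<in> carrier M \<Longrightarrow> y \<in> carrier N \<Longrightarrow>
      e (x \<oplus>\<^bsub>M\<^esub> x', y) \<ominus>\<^bsub>F\<^esub> (e (x, y) \<oplus>\<^bsub>F\<^esub> e (x', y)) \<in> tensor_relations R M N"
    and "x \<in> carrier M \<Longrightarrow> y \<in> carrier N \<Longrightarrow> y' \<in> carrier N \<Longrightarrow>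
      e (x, y \<oplus>\<^bsub>N\<^esub> y') \<ominus>\<^bsub>F\<^esub> (e (x, y) \<oplus>\<^bsub>F\<^esub> e (x, y')) \<in> tensor_relations R M N"
    and "c \<in> carrier R \<Longrightarrow> x \<in> carrier M \<Longrightarrow> y \<in> carrier N \<Longrightarrow>
      e (c \<odot>\<^bsub>M\<^esub> x, y) \<ominus>\<^bsub>F\<^esub> c \<odot>\<^bsub>F\<^esub> e (x, y) \<in> tensor_relations R M N"
    and "c \<in> carrier R \<Longrightarrow> x \<in> carrier M \<Longrightarrow> y \<in> carrier N \<Longrightarrow>
      e (x, c \<odot>\<^bsub>N\<^esub> y) \<ominus>\<^bsub>F\<^esub> c \<odot>\<^bsub>F\<^esub> e (x, y) \<in> tensor_relations R M N"
  unfolding tensor_relations_def Let_def by blast+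

lemma relations_subset: "tensor_relations R M N \<subseteq> carrier F"
proof
  fix z assume "z \<in> tensor_relations R M N"
  then show "z \<in> carrier F"
    by (cases rule: tensor_relations_cases) simp_all
qed

sublocale Q: quotient_of_module R F K
proof (intro quotient_of_module.intro quotient_of_module_axioms.intro F.module_axioms)
  show "submodule K R F"
    unfolding tensor_kernel_def
    by (rule F.submodule_generated_submodule[OF relations_subset])
qed

lemma tensor_module: "module R (tensor R M N)"
  unfolding tensor_def by (rule Q.quotient_module_module)

lemma relation_pure:
  assumes "a \<ominus>\<^bsub>F\<^esub> b \<in> tensor_relations R M N" "a \<in> carrier F" "b \<in> carrier F"
  shows "K +>\<^bsub>F\<^esub> a = K +>\<^bsub>F\<^esub> b"
  unfolding Q.coset_eq_iff[OF assms(2,3)] unfolding tensor_kernel_def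
  using assms(1) submodule_generated_superset by (rule rev_subsetD)

lemma pure_bilinear: "pure R M N \<in> bilinear_maps R M N (tensor R M N)"
proof -
  note proj = linear_mapsD[OF Q.quotient_proj_linear, folded tensor_def]
  note c = e_closed M.M.a_closed N.M.a_closed M.smult_closed N.smult_closed F.M.a_closed F.smult_closed
  show ?thesis
  proof (intro bilinear_mapsI linear_mapsI)
    fix x y assume xy: "x \<in> carrier M" "y \<in> carrier N"
    show "pure R M N x y \<in> carrier (tensor R M N)"
      unfolding pure_def by (intro proj c xy)
    show "pure R M N x y \<in> carrier (tensor R M N)"
      unfolding pure_def by (intro proj c xy)
    fix c assume cR: "c \<in> carrier R"
    show "pure R M N x (c \<odot>\<^bsub>N\<^esub> y) = c \<odot>\<^bsub>tensor R M N\<^esub> pure R M N x y"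
      unfolding pure_def proj(3)[OF cR e_closed[OF xy], symmetric]
      by (rule relation_pure; (intro c xy cR)?) (intro tensor_relations_intros xy cR)
    show "pure R M N (c \<odot>\<^bsub>M\<^esub> x) y = c \<odot>\<^bsub>tensor R M N\<^esub> pure R M N x y"
      unfolding pure_def proj(3)[OF cR e_closed[OF xy], symmetric]
      by (rule relation_pure; (intro c xy cR)?) (intro tensor_relations_intros xy cR)
  next
    fix x y y' assume xy: "x \<in> carrier M" "y \<in> carrier N" "y' \<in> carrier N"
    show "pure R M N x (y \<oplus>\<^bsub>N\<^esub> y') = pure R M N x y \<oplus>\<^bsub>tensor R M N\<^esub> pure R M N x y'"
      unfolding pure_def proj(2)[OF e_closed[OF xy(1,2)] e_closed[OF xy(1,3)], symmetric]
      by (rule relation_pure; (intro c xy)?) (intro tensor_relations_intros xy)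
  next
    fix x x' y assume xy: "y \<in> carrier N" "x \<in> carrier M" "x' \<in> carrier M"
    show "pure R M N (x \<oplus>\<^bsub>M\<^esub> x') y = pure R M N x y \<oplus>\<^bsub>tensor R M N\<^esub> pure R M N x' y"
      unfolding pure_def proj(2)[OF e_closed[OF xy(2,1)] e_closed[OF xy(3,1)], symmetric]
      by (rule relation_pure; (intro c xy)?) (intro tensor_relations_intros xy)
  qed
qed

text \<open>The classes of the basis vectors \<open>e (x, y)\<close> are the pure tensors, so a linear map on the quotient is
  determined by its values there. Identities between tensors are reduced to pure tensors by this lemma.\<close>

lemma tensor_ext:
  assumes "module R P" "f \<in> linear_maps R (tensor R M N) P" "g \<in> linear_maps R (tensor R M N) P"
    and "\<And>x y. x \<in> carrier M \<Longrightarrow> y \<in> carrier N \<Longrightarrow> f (pure R M N x y) = g (pure R M N x y)"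
    and "t \<in> carrier (tensor R M N)"
  shows "f t = g t"
proof -
  from assms(5) obtain a where a: "a \<in> carrier F" "t = K +>\<^bsub>F\<^esub> a"
    unfolding tensor_def Q.quotient_simps by blast
  note proj = Q.quotient_proj_linear[folded tensor_def]
  have "f (K +>\<^bsub>F\<^esub> a) = g (K +>\<^bsub>F\<^esub> a)"
    by (rule free_module_ext[OF M.R.is_cring assms(1) linear_maps_comp[OF assms(2) proj]
          linear_maps_comp[OF assms(3) proj] _ a(1)])
      (use assms(4) in \<open>auto simp: pure_def\<close>)
  then show ?thesis by (simp add: a(2))
qed

text \<open>Bilinearity of \<open>\<beta>\<close> says exactly that its linear extension to the free module kills the four kinds of
  relations. Its kernel is a submodule and hence contains the submodule that they generate.\<close>

lemma tensor_lift_exists: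
  assumes "module R P" "\<beta> \<in> bilinear_maps R M N P"
  shows "\<exists>h\<in>linear_maps R (tensor R M N) P.
    \<forall>x\<in>carrier M. \<forall>y\<in>carrier N. h (pure R M N x y) = \<beta> x y"
proof -
  interpret P: module R P by fact
  define l where "l = free_lift R P (\<lambda>(x, y). \<beta> x y)"
  note bl = linear_mapsD[OF bilinear_mapsD(1)[OF assms(2)]]
    linear_mapsD[OF bilinear_mapsD(2)[OF assms(2)]]
  have l: "l \<in> linear_maps R F P"
    unfolding l_def by (rule free_lift_linear) (auto simp: assms bilinear_maps_closed[OF assms(2)])
  have le: "l (e (x, y)) = \<beta> x y" if "x \<in> carrier M" "y \<in> carrier N" for x y
    using that by (simp add: l_def assms bilinear_maps_closed[OF assms(2)])
  have vanish: "l (a \<ominus>\<^bsub>F\<^esub> b) = \<zero>\<^bsub>P\<^esub>" if "a \<in> carrier F" "b \<in> carrier F" "l a = l b" for a b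
    using that linear_mapsD(1)[OF l]
    by (simp add: linear_maps_minus[OF F.module_axioms assms(1) l] P.minus_eq_zero_iff)
  have "l z = \<zero>\<^bsub>P\<^esub>" if "z \<in> tensor_relations R M N" for z
    using that
    by (cases rule: tensor_relations_cases)
      (simp_all only:, (rule vanish; simp add: linear_mapsD[OF l] le bl)+)
  then have "tensor_relations R M N \<subseteq> {z \<in> carrier F. l z = \<zero>\<^bsub>P\<^esub>}"
    using relations_subset by blast
  then have "K \<subseteq> {z \<in> carrier F. l z = \<zero>\<^bsub>P\<^esub>}"
    unfolding tensor_kernel_def
    by (rule submodule_generated_least[OF kernel_submodule[OF F.module_axioms assms(1) l]])
  then obtain h where "h \<in> linear_maps R (tensor R M N) P" "\<forall>a\<in>carrier F. h (K +>\<^bsub>F\<^esub> a) = l a"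
    using Q.quotient_lift[OF assms(1) l, folded tensor_def] by blast
  then show ?thesis by (intro bexI[of _ h]) (simp_all add: pure_def le)
qed

text \<open>On the carrier the induced map is unique by \<open>tensor_ext\<close>, and extensionality fixes its values elsewhere,
  so the definite description in the definition of \<open>tensor_lift\<close> denotes it.\<close>

lemma tensor_lift:
  assumes "module R P" "\<beta> \<in> bilinear_maps R M N P"
  shows "tensor_lift R M N P \<beta> \<in> linear_maps R (tensor R M N) P"
    and "x \<in> carrier M \<Longrightarrow> y \<in> carrier N \<Longrightarrow> tensor_lift R M N P \<beta> (pure R M N x y) = \<beta> x y"
proof -
  interpret T: module R "tensor R M N" by (rule tensor_module)
  let ?P = "\<lambda>h. h \<in> linear_maps R (tensor R M N) P \<and> h \<in> extensional (carrier (tensor R M N)) \<and>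
      (\<forall>x\<in>carrier M. \<forall>y\<in>carrier N. h (pure R M N x y) = \<beta> x y)"
  obtain h where h: "h \<in> linear_maps R (tensor R M N) P"
    "\<And>x y. x \<in> carrier M \<Longrightarrow> y \<in> carrier N \<Longrightarrow> h (pure R M N x y) = \<beta> x y"
    using tensor_lift_exists[OF assms] by blast
  have "?P (restrict h (carrier (tensor R M N)))"
    using h by (auto simp: linear_maps_def bilinear_maps_closed[OF pure_bilinear] Pi_iff)
  moreover have "f = g" if "?P f" "?P g" for f g
    by (rule extensionalityI[of _ "carrier (tensor R M N)"])
      (use that tensor_ext[OF assms(1), of f g] in auto)
  ultimately have "\<exists>!h. ?P h" by blast
  then have "?P (tensor_lift R M N P \<beta>)"
    unfolding tensor_lift_def by (rule theI')
  then show "tensor_lift R M N P \<beta> \<in> linear_maps R (tensor R M N) P"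
    and "x \<in> carrier M \<Longrightarrow> y \<in> carrier N \<Longrightarrow> tensor_lift R M N P \<beta> (pure R M N x y) = \<beta> x y"
    by blast+
qed

text \<open>A family of bilinear maps that is linear in its parameter induces a family of linear maps with the same
  property. This makes all the partial operations on tensors below bilinear.\<close>

lemma tensor_lift_param_linear:
  assumes "module R P" "module R L"
    and "\<And>z. z \<in> carrier L \<Longrightarrow> \<beta> z \<in> bilinear_maps R M N P"
    and "\<And>x y. x \<in> carrier M \<Longrightarrow> y \<in> carrier N \<Longrightarrow> (\<lambda>z. \<beta> z x y) \<in> linear_maps R L P"
    and t: "t \<in> carrier (tensor R M N)"
  shows "(\<lambda>z. tensor_lift R M N P (\<beta> z) t) \<in> linear_maps R L P"
proof -
  interpret P: module R P by fact
  interpret L: module R L by fact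
  note tl = tensor_lift[OF assms(1) assms(3)]
  note lin = linear_mapsD[OF assms(4)]
  show ?thesis
  proof (rule linear_mapsI)
    show "tensor_lift R M N P (\<beta> z) t \<in> carrier P" if "z \<in> carrier L" for z
      using linear_mapsD(1)[OF tl(1)] that t by blast
  next
    fix z w assume zw: "z \<in> carrier L" "w \<in> carrier L"
    show "tensor_lift R M N P (\<beta> (z \<oplus>\<^bsub>L\<^esub> w)) t
        = tensor_lift R M N P (\<beta> z) t \<oplus>\<^bsub>P\<^esub> tensor_lift R M N P (\<beta> w) t"
      by (rule tensor_ext[OF assms(1) tl(1) linear_maps_plus[OF assms(1) tl(1) tl(1)] _ t])
        (use zw in \<open>simp_all add: tl(2) lin\<close>)
  next
    fix c z assume cz: "c \<in> carrier R" "z \<in> carrier L"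
    have scaled: "(\<lambda>t. c \<odot>\<^bsub>P\<^esub> tensor_lift R M N P (\<beta> z) t) \<in> linear_maps R (tensor R M N) P"
      by (rule linear_maps_comp[OF linear_maps_smult[OF assms(1) cz(1)] tl(1)[OF cz(2)]])
    show "tensor_lift R M N P (\<beta> (c \<odot>\<^bsub>L\<^esub> z)) t = c \<odot>\<^bsub>P\<^esub> tensor_lift R M N P (\<beta> z) t"
      by (rule tensor_ext[OF assms(1) tl(1) scaled _ t])
        (use cz in \<open>simp_all add: tl(2) lin\<close>)
  qed
qed

lemma tensor_lift_param_bilinear:
  assumes "module R P" "module R L"
    and "\<And>z. z \<in> carrier L \<Longrightarrow> \<beta> z \<in> bilinear_maps R M N P"
    and "\<And>x y. x \<in> carrier M \<Longrightarrow> y \<in> carrier N \<Longrightarrow> (\<lambda>z. \<beta> z x y) \<in> linear_maps R L P"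
  shows "(\<lambda>z t. tensor_lift R M N P (\<beta> z) t) \<in> bilinear_maps R L (tensor R M N) P"
  by (intro bilinear_mapsI tensor_lift_param_linear[OF assms] tensor_lift[OF assms(1) assms(3)])

end

lemma tensor_map:
  assumes "tensor_product R M N" "tensor_product R M' N'"
    and "f \<in> linear_maps R M M'" "g \<in> linear_maps R N N'"
  shows "tensor_map R M N M' N' f g \<in> linear_maps R (tensor R M N) (tensor R M' N')"
    and "x \<in> carrier M \<Longrightarrow> y \<in> carrier N \<Longrightarrow>
      tensor_map R M N M' N' f g (pure R M N x y) = pure R M' N' (f x) (g y)"
proof -
  interpret tensor_product R M N by fact
  interpret T': tensor_product R M' N' by fact
  note * = tensor_lift[OF T'.tensor_module bilinear_maps_precomp[OF T'.pure_bilinear assms(3,4)]]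
  show "tensor_map R M N M' N' f g \<in> linear_maps R (tensor R M N) (tensor R M' N')"
    and "x \<in> carrier M \<Longrightarrow> y \<in> carrier N \<Longrightarrow>
      tensor_map R M N M' N' f g (pure R M N x y) = pure R M' N' (f x) (g y)"
    unfolding tensor_map_def by (fact *)+
qed


section \<open>Bilinear operations acting on one tensor factor\<close>

text \<open>For an operation \<open>v\<close>, \<open>lact\<close> sends \<open>u \<otimes> w\<close> to \<open>v x u \<otimes> w\<close>, and \<open>ract\<close> sends it to
  \<open>u \<otimes> v w y\<close>. When \<open>v\<close> is the product of an algebra these are the two actions in the law for
  the coproduct of a product; for the grafting operation they are two of the terms of its coproduct.\<close>

definition lact ::
    "('k, 'r) ring_scheme \<Rightarrow> ('k, 'a, 's) module_scheme \<Rightarrow> ('a \<Rightarrow> 'a \<Rightarrow> 'a)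
      \<Rightarrow> 'a \<Rightarrow> ('a \<times> 'a \<Rightarrow> 'k) set \<Rightarrow> ('a \<times> 'a \<Rightarrow> 'k) set"
  where
  "lact R A v x t = tensor_lift R A A (tensor R A A) (\<lambda>u w. pure R A A (v x u) w) t"

definition ract ::
    "('k, 'r) ring_scheme \<Rightarrow> ('k, 'a, 's) module_scheme \<Rightarrow> ('a \<Rightarrow> 'a \<Rightarrow> 'a)
      \<Rightarrow> ('a \<times> 'a \<Rightarrow> 'k) set \<Rightarrow> 'a \<Rightarrow> ('a \<times> 'a \<Rightarrow> 'k) set"
  where
  "ract R A v t y = tensor_lift R A A (tensor R A A) (\<lambda>u w. pure R A A u (v w y)) t"

text \<open>The tensor \<open>t \<otimes> z\<close> with its brackets moved to the right.\<close>

definition append_factor ::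
    "('k, 'r) ring_scheme \<Rightarrow> ('k, 'a, 's) module_scheme
      \<Rightarrow> ('a \<times> 'a \<Rightarrow> 'k) set \<Rightarrow> 'a \<Rightarrow> ('a \<times> ('a \<times> 'a \<Rightarrow> 'k) set \<Rightarrow> 'k) set"
  where
  "append_factor R A t z =
    tensor_lift R A A (tensor R A (tensor R A A)) (\<lambda>x y. pure R A (tensor R A A) x (pure R A A y z)) t"

locale tensor_powers = module R A
  for R :: "('k, 'r) ring_scheme" and A :: "('k, 'a, 's) module_scheme"
begin

abbreviation "AA \<equiv> tensor R A A"
abbreviation "A_AA \<equiv> tensor R A AA"
abbreviation "AA_A \<equiv> tensor R AA A"
abbreviation "p \<equiv> pure R A A"
abbreviation "p3 \<equiv> pure R A AA"

sublocale T: tensor_product R A A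
  by (intro tensor_product.intro module_axioms)

sublocale AA: module R AA
  by (rule T.tensor_module)

sublocale T3: tensor_product R A AA
  by (intro tensor_product.intro module_axioms T.tensor_module)

sublocale T3': tensor_product R AA A
  by (intro tensor_product.intro module_axioms T.tensor_module)

sublocale A_AA: module R A_AA
  by (rule T3.tensor_module)

lemmas AA_module = T.tensor_module
  and A_AA_module = T3.tensor_module
  and AA_add = AA.M.a_closed AA.M.a_ac
  and A_AA_add = A_AA.M.a_closed A_AA.M.a_ac

lemma p_closed [simp]: "x \<in> carrier A \<Longrightarrow> y \<in> carrier A \<Longrightarrow> p x y \<in> carrier AA"
  by (rule bilinear_maps_closed[OF T.pure_bilinear])

lemma p3_closed [simp]: "x \<in> carrier A \<Longrightarrow> t \<in> carrier AA \<Longrightarrow> p3 x t \<in> carrier A_AA"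
  by (rule bilinear_maps_closed[OF T3.pure_bilinear])

lemma append_factor_pure [simp]:
  assumes "x \<in> carrier A" "y \<in> carrier A" "z \<in> carrier A"
  shows "append_factor R A (p x y) z = p3 x (p y z)"
  unfolding append_factor_def
  by (intro T.tensor_lift(2) A_AA_module assms
      bilinear_maps_precomp[OF T3.pure_bilinear linear_maps_id] bilinear_mapsD(2)[OF T.pure_bilinear])

lemma append_factor_bilinear: "append_factor R A \<in> bilinear_maps R AA A A_AA"
proof -
  have "(\<lambda>z t. append_factor R A t z) \<in> bilinear_maps R A AA A_AA"
    unfolding append_factor_def
    by (intro T.tensor_lift_param_bilinear A_AA_module module_axioms
        bilinear_maps_precomp[OF T3.pure_bilinear linear_maps_id] bilinear_mapsD(2)[OF T.pure_bilinear]
        linear_maps_comp[OF bilinear_mapsD(1)[OF T3.pure_bilinear] bilinear_mapsD(1)[OF T.pure_bilinear]])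
  then show ?thesis by (rule bilinear_maps_flip)
qed

lemma assoc_right:
  shows "assoc_right R A \<in> linear_maps R AA_A A_AA"
    and "t \<in> carrier AA \<Longrightarrow> z \<in> carrier A \<Longrightarrow>
      assoc_right R A (pure R AA A t z) = append_factor R A t z"
  unfolding assoc_right_def Let_def append_factor_def[symmetric]
  by (rule T3'.tensor_lift[OF A_AA_module append_factor_bilinear]; assumption)+

lemma assoc_left:
  shows "assoc_left R A \<in> linear_maps R A_AA AA_A"
    and "x \<in> carrier A \<Longrightarrow> y \<in> carrier A \<Longrightarrow> z \<in> carrier A \<Longrightarrow>
      assoc_left R A (p3 x (p y z)) = pure R AA A (p x y) z"
proof -
  define \<beta> where "\<beta> x = tensor_lift R A A AA_A (\<lambda>y z. pure R AA A (p x y) z)" for x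
  have bil: "(\<lambda>y z. pure R AA A (p x y) z) \<in> bilinear_maps R A A AA_A" if "x \<in> carrier A" for x
    by (intro bilinear_maps_precomp[OF T3'.pure_bilinear _ linear_maps_id]
        bilinear_mapsD(1)[OF T.pure_bilinear] that)
  have "\<beta> \<in> bilinear_maps R A AA AA_A"
    unfolding \<beta>_def
    by (intro T.tensor_lift_param_bilinear T3'.tensor_module module_axioms bil
        linear_maps_comp[OF bilinear_mapsD(2)[OF T3'.pure_bilinear] bilinear_mapsD(2)[OF T.pure_bilinear]])
  note lift = T3.tensor_lift[OF T3'.tensor_module this]
  have eq: "assoc_left R A = tensor_lift R A AA AA_A \<beta>"
    unfolding assoc_left_def Let_def \<beta>_def ..
  show "assoc_left R A \<in> linear_maps R A_AA AA_A"
    unfolding eq by (rule lift(1))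
  show "assoc_left R A (p3 x (p y z)) = pure R AA A (p x y) z"
    if "x \<in> carrier A" "y \<in> carrier A" "z \<in> carrier A"
    using that lift(2)[of x "p y z"] T.tensor_lift(2)[OF T3'.tensor_module bil]
    by (simp add: eq \<beta>_def)
qed

end

locale bilinear_operation = tensor_powers R A
  for R :: "('k, 'r) ring_scheme" and A :: "('k, 'a, 's) module_scheme" +
  fixes v :: "'a \<Rightarrow> 'a \<Rightarrow> 'a"
  assumes v_bilinear: "v \<in> bilinear_maps R A A A"
begin

lemma v_closed [simp]: "x \<in> carrier A \<Longrightarrow> y \<in> carrier A \<Longrightarrow> v x y \<in> carrier A"
  by (rule bilinear_maps_closed[OF v_bilinear])

lemma lact_pure [simp]:
  assumes "x \<in> carrier A" "a \<in> carrier A" "b \<in> carrier A"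
  shows "lact R A v x (p a b) = p (v x a) b"
  unfolding lact_def
  by (intro T.tensor_lift(2) AA_module assms
      bilinear_maps_precomp[OF T.pure_bilinear _ linear_maps_id] bilinear_mapsD(1)[OF v_bilinear])

lemma lact_bilinear: "lact R A v \<in> bilinear_maps R A AA AA"
  unfolding lact_def
  by (intro T.tensor_lift_param_bilinear AA_module module_axioms
      bilinear_maps_precomp[OF T.pure_bilinear _ linear_maps_id] bilinear_mapsD(1)[OF v_bilinear]
      linear_maps_comp[OF bilinear_mapsD(2)[OF T.pure_bilinear] bilinear_mapsD(2)[OF v_bilinear]])

lemma ract_pure [simp]:
  assumes "y \<in> carrier A" "a \<in> carrier A" "b \<in> carrier A"
  shows "ract R A v (p a b) y = p a (v b y)"
  unfolding ract_def
  by (intro T.tensor_lift(2) AA_module assms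
      bilinear_maps_precomp[OF T.pure_bilinear linear_maps_id] bilinear_mapsD(2)[OF v_bilinear])

lemma ract_bilinear: "ract R A v \<in> bilinear_maps R AA A AA"
proof -
  have "(\<lambda>y t. ract R A v t y) \<in> bilinear_maps R A AA AA"
    unfolding ract_def
    by (intro T.tensor_lift_param_bilinear AA_module module_axioms
        bilinear_maps_precomp[OF T.pure_bilinear linear_maps_id] bilinear_mapsD(2)[OF v_bilinear]
        linear_maps_comp[OF bilinear_mapsD(1)[OF T.pure_bilinear] bilinear_mapsD(1)[OF v_bilinear]])
  then show ?thesis by (rule bilinear_maps_flip)
qed

lemma lact_closed [simp]: "x \<in> carrier A \<Longrightarrow> t \<in> carrier AA \<Longrightarrow> lact R A v x t \<in> carrier AA"
  by (rule bilinear_maps_closed[OF lact_bilinear])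

lemma ract_closed [simp]: "t \<in> carrier AA \<Longrightarrow> y \<in> carrier A \<Longrightarrow> ract R A v t y \<in> carrier AA"
  by (rule bilinear_maps_closed[OF ract_bilinear])

text \<open>The rebracketings cancel: each of the last two terms only changes the tensor factor next to the new
  argument. All later computations use this form.\<close>

lemma vee_coproduct_eq:
  assumes "x \<in> carrier A" "dx \<in> carrier AA" "y \<in> carrier A" "dy \<in> carrier AA"
  shows "vee_coproduct R A v x dx y dy = p x y \<oplus>\<^bsub>AA\<^esub> ract R A v dx y \<oplus>\<^bsub>AA\<^esub> lact R A v x dy"
proof -
  define V where "V = tensor_lift R A A A v"
  note V = T.tensor_lift[OF module_axioms v_bilinear, folded V_def]
  note right = tensor_map[OF T3.tensor_product_axioms T.tensor_product_axioms linear_maps_id V(1)]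
  note left = tensor_map[OF T3'.tensor_product_axioms T.tensor_product_axioms V(1) linear_maps_id]
  have "tensor_map R A AA A A (\<lambda>a. a) V (append_factor R A dx y) = ract R A v dx y"
    by (rule T.tensor_ext[OF AA_module
          linear_maps_comp[OF right(1) bilinear_mapsD(2)[OF append_factor_bilinear]]
          bilinear_mapsD(2)[OF ract_bilinear] _ assms(2)])
      (simp_all add: assms right(2) V(2))
  moreover have "tensor_map R AA A A A V (\<lambda>a. a) (assoc_left R A (p3 x dy)) = lact R A v x dy"
    by (rule T.tensor_ext[OF AA_module linear_maps_comp[OF left(1)
          linear_maps_comp[OF assoc_left(1) bilinear_mapsD(1)[OF T3.pure_bilinear]]]
          bilinear_mapsD(1)[OF lact_bilinear] _ assms(4)])
      (simp_all add: assms left(2) V(2) assoc_left(2))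
  ultimately show ?thesis
    using assms by (simp add: vee_coproduct_def Let_def assoc_right(2) V_def)
qed

end


section \<open>Coproducts of a bilinear operation\<close>

text \<open>The assumptions are what the induction step on trees uses about the coproduct: they let coassociativity
  pass from \<open>x\<close> and \<open>y\<close> to \<open>v x y\<close>, and the law for products from \<open>y\<close> to \<open>v x y\<close> as left factor.\<close>

locale vee_coalgebra = bilinear_operation R A v
  for R :: "('k, 'r) ring_scheme" and A :: "('k, 'a, 's) module_scheme"
    and v :: "'a \<Rightarrow> 'a \<Rightarrow> 'a" +
  fixes \<Delta> :: "'a \<Rightarrow> ('a \<times> 'a \<Rightarrow> 'k) set"
  assumes \<Delta>_linear: "\<Delta> \<in> linear_maps R A (tensor R A A)"
    and \<Delta>_v: "x \<in> carrier A \<Longrightarrow> y \<in> carrier A \<Longrightarrow>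
      \<Delta> (v x y) = pure R A A x y \<oplus>\<^bsub>tensor R A A\<^esub> ract R A v (\<Delta> x) y
        \<oplus>\<^bsub>tensor R A A\<^esub> lact R A v x (\<Delta> y)"
begin

abbreviation L :: "'a \<Rightarrow> ('a \<times> 'a \<Rightarrow> 'k) set \<Rightarrow> ('a \<times> 'a \<Rightarrow> 'k) set" where
  "L \<equiv> lact R A v"

abbreviation Rt :: "('a \<times> 'a \<Rightarrow> 'k) set \<Rightarrow> 'a \<Rightarrow> ('a \<times> 'a \<Rightarrow> 'k) set" where
  "Rt \<equiv> ract R A v"

abbreviation J :: "('a \<times> 'a \<Rightarrow> 'k) set \<Rightarrow> 'a \<Rightarrow> ('a \<times> ('a \<times> 'a \<Rightarrow> 'k) set \<Rightarrow> 'k) set" where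
  "J \<equiv> append_factor R A"

lemma \<Delta>_closed [simp]: "x \<in> carrier A \<Longrightarrow> \<Delta> x \<in> carrier AA"
  by (rule linear_mapsD(1)[OF \<Delta>_linear])

text \<open>The threefold tensors below are bracketed to the right. The maps \<open>lact3\<close> and \<open>ract3\<close> apply \<open>v\<close> to the
  first and to the last factor, \<open>coprod_left\<close> and \<open>coprod_right\<close> are \<open>\<Delta> \<otimes> id\<close> and
  \<open>id \<otimes> \<Delta>\<close>, and \<open>middle\<close> sends \<open>a \<otimes> b\<close> and \<open>c \<otimes> d\<close> to \<open>a \<otimes> v b c \<otimes> d\<close>, the
  term that both ways of iterating the coproduct of \<open>v x y\<close> have in common.\<close>

definition lact3 where "lact3 x = tensor_lift R A AA A_AA (\<lambda>u s. p3 (v x u) s)"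
definition ract3 where "ract3 y = tensor_lift R A AA A_AA (\<lambda>u s. p3 u (Rt s y))"
definition middle where "middle s t = tensor_lift R A A A_AA (\<lambda>a b. p3 a (L b t)) s"
definition coprod_left where "coprod_left t = assoc_right R A (tensor_map R A A AA A \<Delta> (\<lambda>a. a) t)"
definition coprod_right where "coprod_right = tensor_map R A A A AA (\<lambda>a. a) \<Delta>"

lemma lact3:
  assumes "x \<in> carrier A"
  shows "lact3 x \<in> linear_maps R A_AA A_AA"
    and "u \<in> carrier A \<Longrightarrow> s \<in> carrier AA \<Longrightarrow> lact3 x (p3 u s) = p3 (v x u) s"
proof -
  have "(\<lambda>u s. p3 (v x u) s) \<in> bilinear_maps R A AA A_AA"
    by (rule bilinear_maps_precomp[OF T3.pure_bilinear bilinear_mapsD(1)[OF v_bilinear assms] linear_maps_id])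
  note * = T3.tensor_lift[OF A_AA_module this]
  show "lact3 x \<in> linear_maps R A_AA A_AA"
    and "u \<in> carrier A \<Longrightarrow> s \<in> carrier AA \<Longrightarrow> lact3 x (p3 u s) = p3 (v x u) s"
    unfolding lact3_def by (fact *)+
qed

lemma ract3:
  assumes "y \<in> carrier A"
  shows "ract3 y \<in> linear_maps R A_AA A_AA"
    and "u \<in> carrier A \<Longrightarrow> s \<in> carrier AA \<Longrightarrow> ract3 y (p3 u s) = p3 u (Rt s y)"
proof -
  have "(\<lambda>u s. p3 u (Rt s y)) \<in> bilinear_maps R A AA A_AA"
    by (rule bilinear_maps_precomp[OF T3.pure_bilinear linear_maps_id bilinear_mapsD(2)[OF ract_bilinear assms]])
  note * = T3.tensor_lift[OF A_AA_module this]
  show "ract3 y \<in> linear_maps R A_AA A_AA"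
    and "u \<in> carrier A \<Longrightarrow> s \<in> carrier AA \<Longrightarrow> ract3 y (p3 u s) = p3 u (Rt s y)"
    unfolding ract3_def by (fact *)+
qed

lemma middle:
  shows "middle \<in> bilinear_maps R AA AA A_AA"
    and "a \<in> carrier A \<Longrightarrow> b \<in> carrier A \<Longrightarrow> t \<in> carrier AA \<Longrightarrow> middle (p a b) t = p3 a (L b t)"
proof -
  have bil: "(\<lambda>a b. p3 a (L b t)) \<in> bilinear_maps R A A A_AA" if "t \<in> carrier AA" for t
    by (rule bilinear_maps_precomp[OF T3.pure_bilinear linear_maps_id bilinear_mapsD(2)[OF lact_bilinear that]])
  have "(\<lambda>t s. middle s t) \<in> bilinear_maps R AA AA A_AA"
    unfolding middle_def
    by (intro T.tensor_lift_param_bilinear A_AA_module AA_module bil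
        linear_maps_comp[OF bilinear_mapsD(1)[OF T3.pure_bilinear] bilinear_mapsD(1)[OF lact_bilinear]])
  then show "middle \<in> bilinear_maps R AA AA A_AA" by (rule bilinear_maps_flip)
  show "a \<in> carrier A \<Longrightarrow> b \<in> carrier A \<Longrightarrow> t \<in> carrier AA \<Longrightarrow> middle (p a b) t = p3 a (L b t)"
    unfolding middle_def by (rule T.tensor_lift(2)[OF A_AA_module bil])
qed

lemma coprod_left:
  shows "coprod_left \<in> linear_maps R AA A_AA"
    and "a \<in> carrier A \<Longrightarrow> b \<in> carrier A \<Longrightarrow> coprod_left (p a b) = J (\<Delta> a) b"
proof -
  note map = tensor_map[OF T.tensor_product_axioms T3'.tensor_product_axioms \<Delta>_linear linear_maps_id]
  show "coprod_left \<in> linear_maps R AA A_AA"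
    unfolding coprod_left_def by (rule linear_maps_comp[OF assoc_right(1) map(1)])
  show "a \<in> carrier A \<Longrightarrow> b \<in> carrier A \<Longrightarrow> coprod_left (p a b) = J (\<Delta> a) b"
    by (simp add: coprod_left_def map(2) assoc_right(2))
qed

lemma coprod_right:
  shows "coprod_right \<in> linear_maps R AA A_AA"
    and "a \<in> carrier A \<Longrightarrow> b \<in> carrier A \<Longrightarrow> coprod_right (p a b) = p3 a (\<Delta> b)"
  unfolding coprod_right_def
  by (rule tensor_map[OF T.tensor_product_axioms T3.tensor_product_axioms linear_maps_id \<Delta>_linear];
      assumption)+

lemma J_closed [simp]: "t \<in> carrier AA \<Longrightarrow> y \<in> carrier A \<Longrightarrow> J t y \<in> carrier A_AA"
  by (rule bilinear_maps_closed[OF append_factor_bilinear])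

lemma middle_closed [simp]: "s \<in> carrier AA \<Longrightarrow> t \<in> carrier AA \<Longrightarrow> middle s t \<in> carrier A_AA"
  by (rule bilinear_maps_closed[OF middle(1)])

lemma closed3 [simp]:
  "t \<in> carrier AA \<Longrightarrow> coprod_left t \<in> carrier A_AA"
  "t \<in> carrier AA \<Longrightarrow> coprod_right t \<in> carrier A_AA"
  "x \<in> carrier A \<Longrightarrow> w \<in> carrier A_AA \<Longrightarrow> lact3 x w \<in> carrier A_AA"
  "x \<in> carrier A \<Longrightarrow> w \<in> carrier A_AA \<Longrightarrow> ract3 x w \<in> carrier A_AA"
  by (simp_all add: linear_mapsD(1)[OF coprod_left(1)] linear_mapsD(1)[OF coprod_right(1)]
      linear_mapsD(1)[OF lact3(1)] linear_mapsD(1)[OF ract3(1)])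

lemmas p3_add = linear_mapsD(2)[OF bilinear_mapsD(1)[OF T3.pure_bilinear]]
lemmas J_add = linear_mapsD(2)[OF bilinear_mapsD(2)[OF append_factor_bilinear]]

lemma J_v:
  assumes "s \<in> carrier AA" "b \<in> carrier A" "y \<in> carrier A"
  shows "J s (v b y) = ract3 y (J s b)"
  by (rule T.tensor_ext[OF A_AA_module bilinear_mapsD(2)[OF append_factor_bilinear]
        linear_maps_comp[OF ract3(1) bilinear_mapsD(2)[OF append_factor_bilinear]] _ assms(1)])
    (simp_all add: assms ract3)

lemma J_L:
  assumes "x \<in> carrier A" "s \<in> carrier AA" "b \<in> carrier A"
  shows "J (L x s) b = lact3 x (J s b)"
  by (rule T.tensor_ext[OF A_AA_module
        linear_maps_comp[OF bilinear_mapsD(2)[OF append_factor_bilinear] bilinear_mapsD(1)[OF lact_bilinear]]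
        linear_maps_comp[OF lact3(1) bilinear_mapsD(2)[OF append_factor_bilinear]] _ assms(2)])
    (simp_all add: assms lact3)

lemma J_Rt:
  assumes "s \<in> carrier AA" "a \<in> carrier A" "b \<in> carrier A"
  shows "J (Rt s a) b = middle s (p a b)"
  by (rule T.tensor_ext[OF A_AA_module
        linear_maps_comp[OF bilinear_mapsD(2)[OF append_factor_bilinear] bilinear_mapsD(2)[OF ract_bilinear]]
        bilinear_mapsD(2)[OF middle(1)] _ assms(1)])
    (simp_all add: assms middle)

text \<open>The map \<open>\<Delta> \<otimes> id\<close> only touches the first factor, so it commutes with operations on the last one.
  The next lemma is its mirror image.\<close>

lemma coprod_left_Rt:
  assumes "t \<in> carrier AA" "y \<in> carrier A"
  shows "coprod_left (Rt t y) = ract3 y (coprod_left t)"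
  by (rule T.tensor_ext[OF A_AA_module linear_maps_comp[OF coprod_left(1) bilinear_mapsD(2)[OF ract_bilinear]]
        linear_maps_comp[OF ract3(1) coprod_left(1)] _ assms(1)])
    (simp_all add: assms coprod_left J_v)

lemma coprod_right_L:
  assumes "x \<in> carrier A" "t \<in> carrier AA"
  shows "coprod_right (L x t) = lact3 x (coprod_right t)"
  by (rule T.tensor_ext[OF A_AA_module linear_maps_comp[OF coprod_right(1) bilinear_mapsD(1)[OF lact_bilinear]]
        linear_maps_comp[OF lact3(1) coprod_right(1)] _ assms(2)])
    (simp_all add: assms coprod_right lact3)

text \<open>Here \<open>\<Delta>\<close> meets the modified factor. For \<open>t = a \<otimes> b\<close> the three terms of
  \<open>\<Delta> (v x a) \<otimes> b\<close> are the three summands on the right. The next lemma is the mirror image.\<close>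

lemma coprod_left_L:
  assumes "x \<in> carrier A" "t \<in> carrier AA"
  shows "coprod_left (L x t) = p3 x t \<oplus>\<^bsub>A_AA\<^esub> middle (\<Delta> x) t \<oplus>\<^bsub>A_AA\<^esub> lact3 x (coprod_left t)"
proof (rule T.tensor_ext[OF A_AA_module linear_maps_comp[OF coprod_left(1) bilinear_mapsD(1)[OF lact_bilinear]] _ _ assms(2)])
  show "(\<lambda>t. p3 x t \<oplus>\<^bsub>A_AA\<^esub> middle (\<Delta> x) t \<oplus>\<^bsub>A_AA\<^esub> lact3 x (coprod_left t)) \<in> linear_maps R AA A_AA"
    by (intro linear_maps_plus A_AA_module bilinear_mapsD(1)[OF T3.pure_bilinear]
        bilinear_mapsD(1)[OF middle(1)] linear_maps_comp[OF lact3(1) coprod_left(1)] assms \<Delta>_closed)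
qed (simp_all add: assms coprod_left \<Delta>_v J_add J_L J_Rt)

lemma coprod_right_Rt:
  assumes "t \<in> carrier AA" "y \<in> carrier A"
  shows "coprod_right (Rt t y) = J t y \<oplus>\<^bsub>A_AA\<^esub> ract3 y (coprod_right t) \<oplus>\<^bsub>A_AA\<^esub> middle t (\<Delta> y)"
proof (rule T.tensor_ext[OF A_AA_module linear_maps_comp[OF coprod_right(1) bilinear_mapsD(2)[OF ract_bilinear]] _ _ assms(1)])
  show "(\<lambda>t. J t y \<oplus>\<^bsub>A_AA\<^esub> ract3 y (coprod_right t) \<oplus>\<^bsub>A_AA\<^esub> middle t (\<Delta> y)) \<in> linear_maps R AA A_AA"
    by (intro linear_maps_plus A_AA_module bilinear_mapsD(2)[OF append_factor_bilinear]
        bilinear_mapsD(2)[OF middle(1)] linear_maps_comp[OF ract3(1) coprod_right(1)] assms \<Delta>_closed)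
qed (simp_all add: assms coprod_right \<Delta>_v p3_add ract3 middle)

text \<open>Expanding both iterated coproducts gives the same summands: \<open>x \<otimes> \<Delta> y\<close>, \<open>\<Delta> x \<otimes> y\<close>,
  the middle term of \<open>\<Delta> x\<close> and \<open>\<Delta> y\<close>, and two summands that agree by the hypotheses on \<open>x\<close>
  and \<open>y\<close>.\<close>

lemma coassociative_v:
  assumes "x \<in> carrier A" "y \<in> carrier A"
    and "coprod_left (\<Delta> x) = coprod_right (\<Delta> x)" "coprod_left (\<Delta> y) = coprod_right (\<Delta> y)"
  shows "coprod_left (\<Delta> (v x y)) = coprod_right (\<Delta> (v x y))"
  using assms
  by (simp add: \<Delta>_v linear_mapsD(2)[OF coprod_left(1)] linear_mapsD(2)[OF coprod_right(1)]
      coprod_left coprod_right coprod_left_Rt coprod_left_L coprod_right_Rt coprod_right_L A_AA_add)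

text \<open>Since \<open>m (v x y) z = v x (m y z)\<close>, the coproduct law of \<open>v\<close> and the hypothesis on \<open>m y z\<close> express the
  left-hand side by the two actions. Multiplying the last factor by \<open>z\<close> commutes with applying \<open>v x\<close> to the first
  one, and where both operations meet in one factor the mixed associativity law applies; this turns the
  summands into those on the right.\<close>

lemma coproduct_mult_v:
  assumes m: "m \<in> bilinear_maps R A A A"
    and assoc: "\<And>x y z. x \<in> carrier A \<Longrightarrow> y \<in> carrier A \<Longrightarrow> z \<in> carrier A \<Longrightarrow> m (v x y) z = v x (m y z)"
    and x: "x \<in> carrier A" and y: "y \<in> carrier A" and z: "z \<in> carrier A"
    and IH: "\<Delta> (m y z) = lact R A m y (\<Delta> z) \<oplus>\<^bsub>AA\<^esub> ract R A m (\<Delta> y) z"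
  shows "\<Delta> (m (v x y) z) = lact R A m (v x y) (\<Delta> z) \<oplus>\<^bsub>AA\<^esub> ract R A m (\<Delta> (v x y)) z"
proof -
  interpret M: bilinear_operation R A m
    by (intro bilinear_operation.intro bilinear_operation_axioms.intro tensor_powers_axioms m)
  have RR: "ract R A m (Rt t y) z = Rt t (m y z)" if "t \<in> carrier AA" for t
    by (rule T.tensor_ext[OF AA_module
          linear_maps_comp[OF bilinear_mapsD(2)[OF M.ract_bilinear] bilinear_mapsD(2)[OF ract_bilinear]]
          bilinear_mapsD(2)[OF ract_bilinear] _ that])
      (simp_all add: x y z assoc)
  have RL: "ract R A m (L x t) z = L x (ract R A m t z)" if "t \<in> carrier AA" for t
    by (rule T.tensor_ext[OF AA_module
          linear_maps_comp[OF bilinear_mapsD(2)[OF M.ract_bilinear] bilinear_mapsD(1)[OF lact_bilinear]]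
          linear_maps_comp[OF bilinear_mapsD(1)[OF lact_bilinear] bilinear_mapsD(2)[OF M.ract_bilinear]] _ that])
      (simp_all add: x y z)
  have LL: "lact R A m (v x y) t = L x (lact R A m y t)" if "t \<in> carrier AA" for t
    by (rule T.tensor_ext[OF AA_module bilinear_mapsD(1)[OF M.lact_bilinear]
          linear_maps_comp[OF bilinear_mapsD(1)[OF lact_bilinear] bilinear_mapsD(1)[OF M.lact_bilinear]] _ that])
      (simp_all add: x y z assoc)
  show ?thesis
    using x y z
    by (simp add: assoc \<Delta>_v IH LL RR RL AA_add
        linear_mapsD(2)[OF bilinear_mapsD(1)[OF lact_bilinear]]
        linear_mapsD(2)[OF bilinear_mapsD(2)[OF M.ract_bilinear]])
qed

end


section \<open>Planar binary trees\<close>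

locale planar_binary_trees = cring R for R :: "('k, 'r) ring_scheme"
begin

abbreviation "F \<equiv> free_module R (UNIV :: pbtree set)"
abbreviation "H \<equiv> H_LR R"
abbreviation "e \<equiv> basis_vec R :: pbtree \<Rightarrow> _"

sublocale F: module R F
  by (rule free_module_module) (rule is_cring)

text \<open>The record \<open>H\<close> differs from the free module only in its multiplicative fields, so both have the same
  linear maps. Terms are normalised to the free module.\<close>

lemma H_simps [simp]:
  "carrier H = carrier F" "zero H = zero F" "add H = add F" "smult H = smult F"
  "mult H = free_lift2 R F (\<lambda>S T. e (under S T))" "one H = e Trivial"
  by (simp_all add: H_LR_def Let_def)

lemma linear_maps_H [simp]:
  "linear_maps R H N = linear_maps R F N" "linear_maps R N H = linear_maps R N F"
  by (simp_all add: linear_maps_def)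

lemma bilinear_maps_H: "bilinear_maps R H H P = bilinear_maps R F F P"
  "bilinear_maps R F F H = bilinear_maps R F F F"
  by (simp_all add: bilinear_maps_def)

lemma H_module: "module R H"
  by (intro moduleI abelian_groupI is_cring)
    (use F.M.add.l_inv_ex in \<open>auto simp: F.M.a_ac F.smult_l_distr F.smult_r_distr F.smult_assoc1\<close>)

lemma e_closed [simp]: "e T \<in> carrier F"
  by (simp add: is_cring)

sublocale tensor_powers R H
  by (intro tensor_powers.intro H_module)

abbreviation "m \<equiv> mult H"
abbreviation "vee \<equiv> vee_LR R"

text \<open>The first statement has the product unfolded because \<open>H_simps\<close> rewrites \<open>mult H\<close>.\<close>

lemma m_e [simp]: "free_lift2 R F (\<lambda>S T. e (under S T)) (e S) (e T) = e (under S T)"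
  and m_bilinear: "m \<in> bilinear_maps R H H H"
  using free_lift2_bilinear[OF F.module_axioms, of UNIV "\<lambda>S T. e (under S T)"]
  by (simp_all add: bilinear_maps_H)

lemma vee_e [simp]: "vee (e S) (e T) = e (Graft S T)"
  and vee_bilinear: "vee \<in> bilinear_maps R H H H"
  using free_lift2_bilinear[OF H_module, of UNIV "\<lambda>S T. e (Graft S T)"]
  by (simp_all add: bilinear_maps_H vee_LR_def)

sublocale bilinear_operation R H vee
  by (intro bilinear_operation.intro bilinear_operation_axioms.intro tensor_powers_axioms vee_bilinear)

sublocale U: bilinear_operation R H m
  by (intro bilinear_operation.intro bilinear_operation_axioms.intro tensor_powers_axioms m_bilinear)

lemmas tree_ext = free_module_ext[OF is_cring, of _ _ "UNIV :: pbtree set"]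
lemmas tree_bilinear_ext = bilinear_free_ext[OF is_cring, of _ _ "UNIV :: pbtree set" "UNIV :: pbtree set"]

text \<open>Both associativity laws have this shape: associativity of the product, and its mixed form with grafting.\<close>

lemma trilinear_ext:
  assumes "\<beta>1 \<in> bilinear_maps R H H H" "\<beta>2 \<in> bilinear_maps R H H H"
    and "\<gamma>1 \<in> bilinear_maps R H H H" "\<gamma>2 \<in> bilinear_maps R H H H"
    and basis: "\<And>S T U. \<beta>1 (\<beta>2 (e S) (e T)) (e U) = \<gamma>1 (e S) (\<gamma>2 (e T) (e U))"
    and x: "x \<in> carrier H" and y: "y \<in> carrier H" and z: "z \<in> carrier H"
  shows "\<beta>1 (\<beta>2 x y) z = \<gamma>1 x (\<gamma>2 y z)"
proof -
  have l: "(\<lambda>x y. \<beta>1 (\<beta>2 x y) z) \<in> bilinear_maps R F F H"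
    using bilinear_maps_comp[OF bilinear_mapsD(2)[OF assms(1) z] assms(2)] by (simp add: bilinear_maps_H)
  have r: "(\<lambda>x y. \<gamma>1 x (\<gamma>2 y z)) \<in> bilinear_maps R F F H"
    using bilinear_maps_precomp[OF assms(3) linear_maps_id bilinear_mapsD(2)[OF assms(4) z]]
    by (simp add: bilinear_maps_H)
  have "\<beta>1 (\<beta>2 (e S) (e T)) z = \<gamma>1 (e S) (\<gamma>2 (e T) z)" for S T
  proof -
    have S: "e S \<in> carrier H" and T: "e T \<in> carrier H" by simp_all
    have l: "(\<lambda>z. \<beta>1 (\<beta>2 (e S) (e T)) z) \<in> linear_maps R F H"
      using bilinear_mapsD(1)[OF assms(1) bilinear_maps_closed[OF assms(2) S T]] by simp
    have r: "(\<lambda>z. \<gamma>1 (e S) (\<gamma>2 (e T) z)) \<in> linear_maps R F H"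
      using linear_maps_comp[OF bilinear_mapsD(1)[OF assms(3) S] bilinear_mapsD(1)[OF assms(4) T]] by simp
    show ?thesis using tree_ext[OF H_module l r basis] z by simp
  qed
  then show ?thesis using tree_bilinear_ext[OF H_module l r] x y by simp
qed

lemma under_Trivial: "under T Trivial = T"
  by (induction T) simp_all

lemma under_assoc: "under (under S T) U = under S (under T U)"
  by (induction S) simp_all

lemma m_assoc: "x \<in> carrier H \<Longrightarrow> y \<in> carrier H \<Longrightarrow> z \<in> carrier H \<Longrightarrow> m (m x y) z = m x (m y z)"
  by (rule trilinear_ext[OF m_bilinear m_bilinear m_bilinear m_bilinear]) (simp_all add: under_assoc)

lemma vee_m: "x \<in> carrier H \<Longrightarrow> y \<in> carrier H \<Longrightarrow> z \<in> carrier H \<Longrightarrow> m (vee x y) z = vee x (m y z)"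
  by (rule trilinear_ext[OF m_bilinear vee_bilinear vee_bilinear m_bilinear]) simp_all

lemma m_one:
  assumes "x \<in> carrier H"
  shows "m (e Trivial) x = x" "m x (e Trivial) = x"
proof -
  have t: "e Trivial \<in> carrier H" by simp
  have i: "(\<lambda>x. x) \<in> linear_maps R F H" using linear_maps_id[of R F] by simp
  have l: "m (e Trivial) \<in> linear_maps R F H" and r: "(\<lambda>x. m x (e Trivial)) \<in> linear_maps R F H"
    using bilinear_mapsD[OF m_bilinear t] unfolding linear_maps_H(1) .
  show "m (e Trivial) x = x" "m x (e Trivial) = x"
    using tree_ext[OF H_module l i, of x] tree_ext[OF H_module r i, of x] assms
    by (simp_all add: under_Trivial)
qed

lemma trees_unitary_assoc_algebra: "unitary_assoc_algebra R H"
proof (intro unitary_assoc_algebra.intro unitary_assoc_algebra_axioms.intro H_module ringI monoidI)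
  note lin = linear_mapsD(2)[OF bilinear_mapsD(1)[OF m_bilinear]]
    linear_mapsD(2)[OF bilinear_mapsD(2)[OF m_bilinear]]
  show "abelian_group H" by (rule module.axioms(2)[OF H_module])
  show "(\<lambda>x y. x \<otimes>\<^bsub>H\<^esub> y) \<in> bilinear_maps R H H H" by (rule m_bilinear)
  show "(x \<oplus>\<^bsub>H\<^esub> y) \<otimes>\<^bsub>H\<^esub> z = x \<otimes>\<^bsub>H\<^esub> z \<oplus>\<^bsub>H\<^esub> y \<otimes>\<^bsub>H\<^esub> z"
    if "x \<in> carrier H" "y \<in> carrier H" "z \<in> carrier H" for x y z
    by (rule lin) (fact that)+
  show "z \<otimes>\<^bsub>H\<^esub> (x \<oplus>\<^bsub>H\<^esub> y) = z \<otimes>\<^bsub>H\<^esub> x \<oplus>\<^bsub>H\<^esub> z \<otimes>\<^bsub>H\<^esub> y"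
    if "x \<in> carrier H" "y \<in> carrier H" "z \<in> carrier H" for x y z
    by (rule lin) (fact that)+
  show "x \<otimes>\<^bsub>H\<^esub> y \<otimes>\<^bsub>H\<^esub> z = x \<otimes>\<^bsub>H\<^esub> (y \<otimes>\<^bsub>H\<^esub> z)"
    if "x \<in> carrier H" "y \<in> carrier H" "z \<in> carrier H" for x y z
    using that by (rule m_assoc)
  show "x \<otimes>\<^bsub>H\<^esub> y \<in> carrier H" if "x \<in> carrier H" "y \<in> carrier H" for x y
    using that by (rule U.v_closed)
  show "\<one>\<^bsub>H\<^esub> \<in> carrier H" by simp
  show "\<one>\<^bsub>H\<^esub> \<otimes>\<^bsub>H\<^esub> x = x" "x \<otimes>\<^bsub>H\<^esub> \<one>\<^bsub>H\<^esub> = x" if "x \<in> carrier H" for x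
    using m_one[OF that] by simp_all
qed

abbreviation "\<Delta> \<equiv> coproduct_LR R"

lemma coproduct_tree_closed: "coproduct_tree R T \<in> carrier AA"
  by (induction T) (simp_all add: vee_coproduct_eq AA_add)

lemma \<Delta>_linear: "\<Delta> \<in> linear_maps R H AA"
  unfolding coproduct_LR_def linear_maps_H
  by (rule free_lift_linear) (auto simp: AA_module coproduct_tree_closed)

lemma \<Delta>_e: "\<Delta> (e T) = coproduct_tree R T"
  unfolding coproduct_LR_def by (intro free_lift_basis_vec AA_module coproduct_tree_closed)

text \<open>On trees this is the recursive definition of the coproduct, and both sides are bilinear.\<close>

lemma \<Delta>_vee:
  assumes "x \<in> carrier H" "y \<in> carrier H"
  shows "\<Delta> (vee x y) = p x y \<oplus>\<^bsub>AA\<^esub> ract R H vee (\<Delta> x) y \<oplus>\<^bsub>AA\<^esub> lact R H vee x (\<Delta> y)"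
proof -
  have l: "(\<lambda>x y. \<Delta> (vee x y)) \<in> bilinear_maps R F F AA"
    using bilinear_maps_comp[OF \<Delta>_linear vee_bilinear] unfolding bilinear_maps_H(1) .
  have r: "(\<lambda>x y. p x y \<oplus>\<^bsub>AA\<^esub> ract R H vee (\<Delta> x) y \<oplus>\<^bsub>AA\<^esub> lact R H vee x (\<Delta> y)) \<in> bilinear_maps R F F AA"
    unfolding bilinear_maps_H(1)[symmetric]
    by (intro bilinear_maps_plus AA_module T.pure_bilinear
        bilinear_maps_precomp[OF ract_bilinear \<Delta>_linear linear_maps_id]
        bilinear_maps_precomp[OF lact_bilinear linear_maps_id \<Delta>_linear])
  show ?thesis
    by (rule tree_bilinear_ext[OF AA_module l r])
      (use assms in \<open>simp_all add: \<Delta>_e vee_coproduct_eq coproduct_tree_closed\<close>)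
qed

sublocale vee_coalgebra R H vee \<Delta>
  by (intro vee_coalgebra.intro vee_coalgebra_axioms.intro bilinear_operation_axioms \<Delta>_linear \<Delta>_vee)

lemma \<Delta>_coassociative:
  assumes "x \<in> carrier H"
  shows "coprod_left (\<Delta> x) = coprod_right (\<Delta> x)"
proof -
  have l: "(\<lambda>x. coprod_left (\<Delta> x)) \<in> linear_maps R F A_AA" and r: "(\<lambda>x. coprod_right (\<Delta> x)) \<in> linear_maps R F A_AA"
    using linear_maps_comp[OF coprod_left(1) \<Delta>_linear] linear_maps_comp[OF coprod_right(1) \<Delta>_linear]
    unfolding linear_maps_H(1) .
  have "coprod_left (\<Delta> (e T)) = coprod_right (\<Delta> (e T))" for T
  proof (induction T)
    case Trivial
    show ?case
      by (simp add: \<Delta>_e linear_maps_zero[OF AA_module A_AA_module coprod_left(1)]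
          linear_maps_zero[OF AA_module A_AA_module coprod_right(1)])
  next
    case (Graft T U)
    then show ?case using coassociative_v[of "e T" "e U"] by simp
  qed
  then show ?thesis using tree_ext[OF A_AA_module l r] assms by simp
qed

text \<open>The induction is on the left factor only, as in the recursive definition of \<open>under\<close>. The base
  case says that the unit acts as the identity and has coproduct zero.\<close>

lemma \<Delta>_m:
  assumes "x \<in> carrier H" "y \<in> carrier H"
  shows "\<Delta> (m x y) = lact R H m x (\<Delta> y) \<oplus>\<^bsub>AA\<^esub> ract R H m (\<Delta> x) y"
proof -
  have l: "(\<lambda>x. \<Delta> (m x y)) \<in> linear_maps R F AA"
    using linear_maps_comp[OF \<Delta>_linear bilinear_mapsD(2)[OF m_bilinear assms(2)]]
    unfolding linear_maps_H .
  have r: "(\<lambda>x. lact R H m x (\<Delta> y) \<oplus>\<^bsub>AA\<^esub> ract R H m (\<Delta> x) y) \<in> linear_maps R F AA"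
    unfolding linear_maps_H(1)[symmetric]
    by (intro linear_maps_plus AA_module bilinear_mapsD(2)[OF U.lact_bilinear] \<Delta>_closed assms
        linear_maps_comp[OF bilinear_mapsD(2)[OF U.ract_bilinear assms(2)] \<Delta>_linear])
  have z: "ract R H m \<zero>\<^bsub>AA\<^esub> y = \<zero>\<^bsub>AA\<^esub>"
    by (rule linear_maps_zero[OF AA_module AA_module bilinear_mapsD(2)[OF U.ract_bilinear assms(2)]])
  have t: "e Trivial \<in> carrier H" by simp
  have u: "lact R H m (e Trivial) t = t" if "t \<in> carrier AA" for t
    by (rule T.tensor_ext[OF AA_module bilinear_mapsD(1)[OF U.lact_bilinear t] linear_maps_id _ that])
      (simp only: U.lact_pure[OF t] m_one)
  have basis: "\<Delta> (m (e T) y) = lact R H m (e T) (\<Delta> y) \<oplus>\<^bsub>AA\<^esub> ract R H m (\<Delta> (e T)) y" for T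
  proof (induction T)
    case Trivial
    show ?case
      by (simp only: m_one u \<Delta>_closed assms \<Delta>_e coproduct_tree.simps z AA.M.r_zero)
  next
    case (Graft T U)
    have "e T \<in> carrier H" "e U \<in> carrier H" by simp_all
    then show ?case
      unfolding vee_e[symmetric] by (intro coproduct_mult_v m_bilinear vee_m assms Graft)
  qed
  show ?thesis using tree_ext[OF AA_module l r basis] assms(1) by simp
qed

end

theorem proposition3p9:
  fixes R :: "('k, 'r) ring_scheme"
  assumes "cring R"
  shows "unitary_infinitesimal_under_vee_bialgebra R (H_LR R) (coproduct_LR R) (vee_LR R)"
proof -
  interpret planar_binary_trees R by (intro planar_binary_trees.intro assms)
  show ?thesis
  proof (intro unitary_infinitesimal_under_vee_bialgebra.intro unitary_under_vee_algebra.intro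
      unitary_infinitesimal_bialgebra.intro trees_unitary_assoc_algebra
      unitary_infinitesimal_under_vee_bialgebra_axioms.intro unitary_under_vee_algebra_axioms.intro
      unitary_infinitesimal_bialgebra_axioms.intro vee_bilinear vee_m \<Delta>_linear)
    fix x y assume xy: "x \<in> carrier H" "y \<in> carrier H"
    show "assoc_right R H (tensor_map R H H AA H \<Delta> (\<lambda>a. a) (\<Delta> x)) = tensor_map R H H H AA (\<lambda>a. a) \<Delta> (\<Delta> x)"
      using \<Delta>_coassociative[OF xy(1)] by (simp only: coprod_left_def coprod_right_def)
    show "\<Delta> (x \<otimes>\<^bsub>H\<^esub> y) = left_action R H x (\<Delta> y) \<oplus>\<^bsub>AA\<^esub> right_action R H (\<Delta> x) y"
      using \<Delta>_m[OF xy] by (simp only: lact_def ract_def left_action_def right_action_def)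
    show "\<Delta> (vee x y) = vee_coproduct R H vee x (\<Delta> x) y (\<Delta> y)"
      using xy by (simp only: \<Delta>_vee vee_coproduct_eq \<Delta>_closed)
  qed
qed

end
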